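(* There exist topologically numerically transitive operators on $\ell^2(\mathbb N)$ and C*-transitive operators on $\tilde\ell_2(B_0(H))$ that are not $\varepsilon$-cyclic for any $\varepsilon\in(0,1)$.
   Context: $H$ is a complex separable Hilbert space with an orthonormal basis $\{e_j\}_{j\in\mathbb Z}$, $B_0(H)$ is the C*-algebra of compact operators on $H$. $\tilde\ell_2(B_0(H))$ is the standard Hilbert module over $B_0(H)$: sequences $x=(x_j)_{j\in\mathbb N}$ in $B_0(H)$ with $\sum_j x_j^*x_j$ norm convergent, with $\varphi(x,y)=\sum_{j}y_j^*x_j$ and norm $\|x\|=\|\varphi(x,x)\|^{1/2}$. With $X=\tilde\ell_2(B_0(H))$ and unit sphere $S(X)$, $T\in\mathcal B(X)$ is C*-transitive if for every nonempty open $W\subseteq S(X)\times S(X)$ and nonempty open $O\subseteq B_0(H)$ there exist $n\in\mathbb N$ and $(x,y)\in W$ with $\varphi(T^nx,y)\in O$. For a complex Banach space $X$, $\Pi(X):=\{(x,x^* )\in S_X\times S_{X^*}:x^*(x)=1\}$ ($S_X,S_{X^*}$ unit spheres) with the topology induced by the norm $\max\{\|x\|,\|x^*\|\}$; $T\in\mathcal B(X)$ is topologically numerically transitive if for every nonempty open $U\subset\Pi(X)$ and nonempty open $V\subset\mathbb C$ there exist $n\ge0$ and $(x,x^* )\in U$ with $x^*(T^nx)\in V$. For $\varepsilon\in(0,1)$, $T\in\mathcal B(X)$ is $\varepsilon$-cyclic if there is $x\in X$ such that, with $M=\operatorname{span}\{x\}$, for every $y\in X$ there is $z\in\overline{\operatorname{span}\left(\bigcup_{k=1}^\infty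 T^k(M)\right)}$ with $\|z-y\|\le\varepsilon\|y\|$. *)

theory Defs
  imports "HOL-Analysis.Analysis"
begin

section \<open>Complex normed spaces and complex Hilbert spaces\<close>

class complex_normed_vector = real_normed_vector +
  fixes scaleC :: "complex \<Rightarrow> 'a \<Rightarrow> 'a"  (infixr "*\<^sub>C" 75)
  assumes scaleC_add_right: "c *\<^sub>C (x + y) = c *\<^sub>C x + c *\<^sub>C y"
    and scaleC_add_left: "(c + d) *\<^sub>C x = c *\<^sub>C x + d *\<^sub>C x"
    and scaleC_scaleC: "c *\<^sub>C d *\<^sub>C x = (c * d) *\<^sub>C x"
    and scaleC_of_real: "complex_of_real r *\<^sub>C x = r *\<^sub>R x"
    and norm_scaleC: "norm (c *\<^sub>C x) = cmod c * norm x"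

lemma scaleC_one [simp]: "1 *\<^sub>C (x :: 'a :: complex_normed_vector) = x"
  using scaleC_of_real[of 1 x] by simp

global_interpretation complex_vector:
  vector_space "scaleC :: complex \<Rightarrow> 'a \<Rightarrow> 'a :: complex_normed_vector"
  by unfold_locales (auto simp: scaleC_add_right scaleC_add_left scaleC_scaleC)

abbreviation cspan :: "'a :: complex_normed_vector set \<Rightarrow> 'a set"
  where "cspan \<equiv> complex_vector.span"

abbreviation clinear :: "('a :: complex_normed_vector \<Rightarrow> 'b :: complex_normed_vector) \<Rightarrow> bool"
  where "clinear \<equiv> Vector_Spaces.linear scaleC scaleC"

definition bounded_clinear ::
    "('a :: complex_normed_vector \<Rightarrow> 'b :: complex_normed_vector) \<Rightarrow> bool"
  where "bounded_clinear T \<longleftrightarrow> clinear T \<and> (\<exists>K. \<forall>x. norm (T x) \<le> K * norm x)"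

text \<open>\<^term>\<open>cinner\<close> is linear in the first and conjugate linear in the second argument.\<close>

class complex_hilbert = complex_normed_vector + complete_space +
  fixes cinner :: "'a \<Rightarrow> 'a \<Rightarrow> complex"
  assumes cinner_commute: "cinner x y = cnj (cinner y x)"
    and cinner_add_left: "cinner (x + y) z = cinner x z + cinner y z"
    and cinner_scaleC_left: "cinner (c *\<^sub>C x) y = c * cinner x y"
    and cinner_self: "cinner x x = complex_of_real ((norm x)\<^sup>2)"

subclass (in complex_hilbert) banach ..

definition orthonormal_basis :: "('i \<Rightarrow> 'h :: complex_hilbert) \<Rightarrow> bool"
  where "orthonormal_basis e \<longleftrightarrow>
    (\<forall>i j. cinner (e i) (e j) = (if i = j then 1 else 0)) \<and> closure (cspan (range e)) = UNIV"

instantiation complex :: complex_normed_vector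
begin
definition scaleC_complex_def: "scaleC = ((*) :: complex \<Rightarrow> complex \<Rightarrow> complex)"
instance
  by standard (simp_all add: scaleC_complex_def algebra_simps norm_mult scaleR_conv_of_real)
end

lemma bounded_linear_scaleC:
  "bounded_linear (\<lambda>x :: 'a :: complex_normed_vector. c *\<^sub>C x)"
proof (rule bounded_linear_intro)
  show "c *\<^sub>C (r *\<^sub>R x) = r *\<^sub>R (c *\<^sub>C x)" for r and x :: 'a
    by (simp add: scaleC_of_real[symmetric] scaleC_scaleC mult.commute)
  show "norm (c *\<^sub>C x) \<le> norm x * cmod c" for x :: 'a
    by (simp add: norm_scaleC mult.commute)
qed (rule scaleC_add_right)

instantiation blinfun :: (real_normed_vector, complex_normed_vector) complex_normed_vector
begin
lift_definition scaleC_blinfun :: "complex \<Rightarrow> 'a \<Rightarrow>\<^sub>L 'b \<Rightarrow> 'a \<Rightarrow>\<^sub>L 'b" is "\<lambda>c f x. c *\<^sub>C f x"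
  by (rule bounded_linear_compose[OF bounded_linear_scaleC])
instance
proof
  fix c d :: complex and r :: real and f g :: "'a \<Rightarrow>\<^sub>L 'b"
  show "c *\<^sub>C (f + g) = c *\<^sub>C f + c *\<^sub>C g" by transfer (simp add: scaleC_add_right)
  show "(c + d) *\<^sub>C f = c *\<^sub>C f + d *\<^sub>C f" by transfer (simp add: scaleC_add_left)
  show "c *\<^sub>C d *\<^sub>C f = (c * d) *\<^sub>C f" by transfer (simp add: scaleC_scaleC)
  show "complex_of_real r *\<^sub>C f = r *\<^sub>R f" by transfer (simp add: scaleC_of_real)
  show "norm (c *\<^sub>C f) = cmod c * norm f"
  proof transfer
    fix c :: complex and f :: "'a \<Rightarrow> 'b"
    assume f: "bounded_linear f"
    have le: "onorm (\<lambda>x. c *\<^sub>C g x) \<le> cmod c * onorm g" if "bounded_linear g"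
      for c and g :: "'a \<Rightarrow> 'b"
      using onorm[OF that]
      by (intro onorm_bound)
        (auto simp: norm_scaleC mult.assoc onorm_pos_le[OF that] intro!: mult_left_mono)
    show "onorm (\<lambda>x. c *\<^sub>C f x) = cmod c * onorm f"
    proof (cases "c = 0")
      case True
      then show ?thesis by (simp add: onorm_zero)
    next
      case False
      have "onorm (\<lambda>x. inverse c *\<^sub>C c *\<^sub>C f x) \<le> cmod (inverse c) * onorm (\<lambda>x. c *\<^sub>C f x)"
        by (intro le bounded_linear_compose[OF bounded_linear_scaleC] f)
      then have "onorm f \<le> onorm (\<lambda>x. c *\<^sub>C f x) / cmod c"
        using False by (simp add: scaleC_scaleC norm_inverse divide_inverse mult.commute)
      then have "cmod c * onorm f \<le> onorm (\<lambda>x. c *\<^sub>C f x)"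
        using False by (simp add: field_simps)
      with le[OF f, of c] show ?thesis by linarith
    qed
  qed
qed
end

lemma scaleC_blinfun_apply [simp]: "blinfun_apply (c *\<^sub>C f) x = c *\<^sub>C blinfun_apply f x"
  by transfer simp

lemma clinear_scaleC: "clinear f \<Longrightarrow> f (c *\<^sub>C x) = c *\<^sub>C f x"
  by (simp add: Vector_Spaces.linear_iff)

lemma clinear_blinfunI: "(\<And>c x. blinfun_apply f (c *\<^sub>C x) = c *\<^sub>C f x) \<Longrightarrow> clinear (blinfun_apply f)"
  by (simp add: Vector_Spaces.linear_iff complex_vector.vector_space_axioms blinfun.add_right)


section \<open>The Hilbert space of square-summable families\<close>

lemma L2_set_bounded_summable:
  fixes x :: "'i \<Rightarrow> complex"
  assumes "\<And>F. finite F \<Longrightarrow> L2_set (\<lambda>i. cmod (x i)) F \<le> C"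
  shows "(\<lambda>i. (cmod (x i))\<^sup>2) summable_on UNIV" "sqrt (\<Sum>\<^sub>\<infinity>i. (cmod (x i))\<^sup>2) \<le> C"
proof -
  have C: "0 \<le> C" using assms[of "{}"] by simp
  have le: "(\<Sum>i\<in>F. (cmod (x i))\<^sup>2) \<le> C\<^sup>2" if "finite F" for F
    using assms[OF that] C by (metis L2_set_def sqrt_le_D)
  show s: "(\<lambda>i. (cmod (x i))\<^sup>2) summable_on UNIV"
    by (rule nonneg_bdd_above_summable_on) (auto intro!: bdd_aboveI2[where M = "C\<^sup>2"] le)
  have "(\<Sum>\<^sub>\<infinity>i. (cmod (x i))\<^sup>2) \<le> C\<^sup>2"
    by (rule infsum_le_finite_sums[OF s]) (auto intro: le)
  then show "sqrt (\<Sum>\<^sub>\<infinity>i. (cmod (x i))\<^sup>2) \<le> C"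
    using C by (simp add: real_le_lsqrt)
qed

lemma L2_set_le_infsum:
  fixes x :: "'i \<Rightarrow> complex"
  assumes "(\<lambda>i. (cmod (x i))\<^sup>2) summable_on UNIV" "finite F"
  shows "L2_set (\<lambda>i. cmod (x i)) F \<le> sqrt (\<Sum>\<^sub>\<infinity>i. (cmod (x i))\<^sup>2)"
  unfolding L2_set_def using assms by (intro real_sqrt_le_mono finite_sum_le_infsum) auto

lemma L2_set_norm_triangle:
  "L2_set (\<lambda>i. norm (f i + g i)) F \<le> L2_set (\<lambda>i. norm (f i)) F + L2_set (\<lambda>i. norm (g i)) F"
  by (rule order_trans[OF L2_set_mono L2_set_triangle_ineq]) (auto intro: norm_triangle_ineq)

typedef 'i ell2 = "{x :: 'i \<Rightarrow> complex. (\<lambda>i. (cmod (x i))\<^sup>2) summable_on UNIV}"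
  by (rule exI[of _ "\<lambda>_. 0"]) simp

setup_lifting type_definition_ell2

lemma summable_Rep_ell2: "(\<lambda>i. (cmod (Rep_ell2 x i))\<^sup>2) summable_on UNIV"
  using Rep_ell2[of x] by simp

instantiation ell2 :: (type) complex_normed_vector
begin

lift_definition zero_ell2 :: "'a ell2" is "\<lambda>_. 0" by simp

lift_definition plus_ell2 :: "'a ell2 \<Rightarrow> 'a ell2 \<Rightarrow> 'a ell2" is "\<lambda>x y i. x i + y i"
proof -
  fix x y :: "'a \<Rightarrow> complex"
  assume "(\<lambda>i. (cmod (x i))\<^sup>2) summable_on UNIV" "(\<lambda>i. (cmod (y i))\<^sup>2) summable_on UNIV"
  from L2_set_le_infsum[OF this(1)] L2_set_le_infsum[OF this(2)]
  have "L2_set (\<lambda>i. cmod (x i + y i)) F \<le>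
      sqrt (\<Sum>\<^sub>\<infinity>i. (cmod (x i))\<^sup>2) + sqrt (\<Sum>\<^sub>\<infinity>i. (cmod (y i))\<^sup>2)" if "finite F" for F
    by (rule order_trans[OF L2_set_norm_triangle add_mono]) (use that in blast)+
  then show "(\<lambda>i. (cmod (x i + y i))\<^sup>2) summable_on UNIV" by (rule L2_set_bounded_summable)
qed

lift_definition scaleC_ell2 :: "complex \<Rightarrow> 'a ell2 \<Rightarrow> 'a ell2" is "\<lambda>c x i. c * x i"
  by (simp add: norm_mult power_mult_distrib summable_on_cmult_right)

definition scaleR_ell2 :: "real \<Rightarrow> 'a ell2 \<Rightarrow> 'a ell2"
  where "scaleR_ell2 r x = complex_of_real r *\<^sub>C x"

definition uminus_ell2 :: "'a ell2 \<Rightarrow> 'a ell2" where "uminus_ell2 x = (- 1) *\<^sub>C x"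

definition minus_ell2 :: "'a ell2 \<Rightarrow> 'a ell2 \<Rightarrow> 'a ell2" where "minus_ell2 x y = x + - y"

lift_definition norm_ell2 :: "'a ell2 \<Rightarrow> real" is "\<lambda>x. sqrt (\<Sum>\<^sub>\<infinity>i. (cmod (x i))\<^sup>2)" .

definition sgn_ell2 :: "'a ell2 \<Rightarrow> 'a ell2" where "sgn_ell2 x = inverse (norm x) *\<^sub>R x"

definition dist_ell2 :: "'a ell2 \<Rightarrow> 'a ell2 \<Rightarrow> real" where "dist_ell2 x y = norm (x - y)"

definition uniformity_ell2 :: "('a ell2 \<times> 'a ell2) filter"
  where "uniformity_ell2 = (INF e\<in>{0<..}. principal {(x, y). dist x y < e})"

definition open_ell2 :: "'a ell2 set \<Rightarrow> bool"
  where "open_ell2 U = (\<forall>x\<in>U. \<forall>\<^sub>F (x', y) in uniformity. x' = x \<longrightarrow> y \<in> U)"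

instance
proof
  fix x y z :: "'a ell2" and c d :: complex and r s :: real
  show "x + y + z = x + (y + z)" "x + y = y + x" "0 + x = x"
    by (transfer; simp add: fun_eq_iff)+
  show "- x + x = 0" unfolding uminus_ell2_def by transfer (simp add: fun_eq_iff)
  show "x - y = x + - y" by (rule minus_ell2_def)
  have addr: "c *\<^sub>C (x + y) = c *\<^sub>C x + c *\<^sub>C y"
    and addl: "(c + d) *\<^sub>C x = c *\<^sub>C x + d *\<^sub>C x"
    and sc: "c *\<^sub>C d *\<^sub>C x = (c * d) *\<^sub>C x" for c d and x y :: "'a ell2"
    by (transfer; simp add: algebra_simps)+
  show "c *\<^sub>C (x + y) = c *\<^sub>C x + c *\<^sub>C y" by (rule addr)
  show "(c + d) *\<^sub>C x = c *\<^sub>C x + d *\<^sub>C x" by (rule addl)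
  show "c *\<^sub>C d *\<^sub>C x = (c * d) *\<^sub>C x" by (rule sc)
  show "complex_of_real r *\<^sub>C x = r *\<^sub>R x" by (simp add: scaleR_ell2_def)
  show "r *\<^sub>R (x + y) = r *\<^sub>R x + r *\<^sub>R y" "(r + s) *\<^sub>R x = r *\<^sub>R x + s *\<^sub>R x"
    "r *\<^sub>R s *\<^sub>R x = (r * s) *\<^sub>R x" "1 *\<^sub>R x = x"
    by (simp_all add: scaleR_ell2_def addr addl sc) (transfer; simp)
  have nC: "norm (c *\<^sub>C x) = cmod c * norm x" for c and x :: "'a ell2"
    by transfer (simp add: norm_mult power_mult_distrib infsum_cmult_right' real_sqrt_mult)
  show "norm (c *\<^sub>C x) = cmod c * norm x" by (rule nC)
  show "norm (r *\<^sub>R x) = \<bar>r\<bar> * norm x" by (simp add: scaleR_ell2_def nC)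
  show "norm (x + y) \<le> norm x + norm y"
  proof transfer
    fix x y :: "'a \<Rightarrow> complex"
    assume "(\<lambda>i. (cmod (x i))\<^sup>2) summable_on UNIV" "(\<lambda>i. (cmod (y i))\<^sup>2) summable_on UNIV"
    from L2_set_le_infsum[OF this(1)] L2_set_le_infsum[OF this(2)]
    have "L2_set (\<lambda>i. cmod (x i + y i)) F \<le>
        sqrt (\<Sum>\<^sub>\<infinity>i. (cmod (x i))\<^sup>2) + sqrt (\<Sum>\<^sub>\<infinity>i. (cmod (y i))\<^sup>2)" if "finite F" for F
      by (rule order_trans[OF L2_set_norm_triangle add_mono]) (use that in blast)+
    then show "sqrt (\<Sum>\<^sub>\<infinity>i. (cmod (x i + y i))\<^sup>2) \<le>
        sqrt (\<Sum>\<^sub>\<infinity>i. (cmod (x i))\<^sup>2) + sqrt (\<Sum>\<^sub>\<infinity>i. (cmod (y i))\<^sup>2)"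
      by (rule L2_set_bounded_summable)
  qed
  show "norm x = 0 \<longleftrightarrow> x = 0"
  proof transfer
    fix x :: "'a \<Rightarrow> complex"
    assume s: "(\<lambda>i. (cmod (x i))\<^sup>2) summable_on UNIV"
    show "sqrt (\<Sum>\<^sub>\<infinity>i. (cmod (x i))\<^sup>2) = 0 \<longleftrightarrow> x = (\<lambda>_. 0)"
    proof
      assume "sqrt (\<Sum>\<^sub>\<infinity>i. (cmod (x i))\<^sup>2) = 0"
      then have "cmod (x i) \<le> 0" for i
        using L2_set_le_infsum[OF s, of "{i}"] by simp
      then show "x = (\<lambda>_. 0)" by auto
    qed simp
  qed
  show "sgn x = inverse (norm x) *\<^sub>R x" by (rule sgn_ell2_def)
  show "dist x y = norm (x - y)" by (rule dist_ell2_def)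
  show "uniformity = (INF e\<in>{0<..}. principal {(x :: 'a ell2, y). dist x y < e})"
    by (rule uniformity_ell2_def)
  show "open U = (\<forall>x\<in>U. \<forall>\<^sub>F (x', y) in uniformity. x' = x \<longrightarrow> y \<in> U)" for U :: "'a ell2 set"
    by (rule open_ell2_def)
qed

end

lemma Rep_ell2_minus: "Rep_ell2 (x - y) i = Rep_ell2 x i - Rep_ell2 y i"
  unfolding minus_ell2_def uminus_ell2_def plus_ell2.rep_eq scaleC_ell2.rep_eq by simp

lemma L2_set_le_norm_ell2: "finite F \<Longrightarrow> L2_set (\<lambda>i. cmod (Rep_ell2 x i)) F \<le> norm x"
  unfolding norm_ell2.rep_eq by (rule L2_set_le_infsum[OF summable_Rep_ell2])

lemma norm_ell2_leI:
  "(\<And>F. finite F \<Longrightarrow> L2_set (\<lambda>i. cmod (Rep_ell2 x i)) F \<le> C) \<Longrightarrow> norm x \<le> C"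
  unfolding norm_ell2.rep_eq by (rule L2_set_bounded_summable)

lemma summable_ell2_product: "(\<lambda>i. Rep_ell2 x i * cnj (Rep_ell2 y i)) summable_on UNIV"
proof (rule abs_summable_summable, rule Infinite_Sum.abs_summable_on_comparison_test')
  show "(\<lambda>i. (cmod (Rep_ell2 x i))\<^sup>2 + (cmod (Rep_ell2 y i))\<^sup>2) summable_on UNIV"
    by (intro summable_on_add summable_Rep_ell2)
  fix i
  have "2 * (cmod (Rep_ell2 x i) * cmod (Rep_ell2 y i))
      \<le> (cmod (Rep_ell2 x i))\<^sup>2 + (cmod (Rep_ell2 y i))\<^sup>2"
    using sum_squares_bound[of "cmod (Rep_ell2 x i)" "cmod (Rep_ell2 y i)"] by simp
  moreover have "0 \<le> cmod (Rep_ell2 x i) * cmod (Rep_ell2 y i)" by simp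
  ultimately show "cmod (Rep_ell2 x i * cnj (Rep_ell2 y i))
      \<le> (cmod (Rep_ell2 x i))\<^sup>2 + (cmod (Rep_ell2 y i))\<^sup>2"
    unfolding norm_mult complex_mod_cnj by linarith
qed

instantiation ell2 :: (type) complex_hilbert
begin

definition cinner_ell2 :: "'a ell2 \<Rightarrow> 'a ell2 \<Rightarrow> complex"
  where "cinner_ell2 x y = (\<Sum>\<^sub>\<infinity>i. Rep_ell2 x i * cnj (Rep_ell2 y i))"

instance
proof
  fix x y z :: "'a ell2" and c :: complex
  show "cinner x y = cnj (cinner y x)"
    unfolding cinner_ell2_def infsum_cnj[symmetric] by (simp add: mult.commute)
  show "cinner (x + y) z = cinner x z + cinner y z"
    unfolding cinner_ell2_def
    by (simp add: plus_ell2.rep_eq distrib_right infsum_add summable_ell2_product)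
  show "cinner (c *\<^sub>C x) y = c * cinner x y"
    unfolding cinner_ell2_def
    by (simp add: scaleC_ell2.rep_eq infsum_cmult_right' mult.assoc)
  have "0 \<le> (\<Sum>\<^sub>\<infinity>i. (cmod (Rep_ell2 x i))\<^sup>2)" by (rule infsum_nonneg) simp
  then have n: "(norm x)\<^sup>2 = (\<Sum>\<^sub>\<infinity>i. (cmod (Rep_ell2 x i))\<^sup>2)"
    by (simp add: norm_ell2.rep_eq)
  have "((\<lambda>i. complex_of_real ((cmod (Rep_ell2 x i))\<^sup>2)) has_sum complex_of_real ((norm x)\<^sup>2)) UNIV"
    unfolding has_sum_of_real_iff n by (rule has_sum_infsum[OF summable_Rep_ell2])
  then show "cinner x x = complex_of_real ((norm x)\<^sup>2)"
    unfolding cinner_ell2_def complex_norm_square[symmetric] by (rule infsumI)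
next
  fix X :: "nat \<Rightarrow> 'a ell2"
  assume X: "Cauchy X"
  have coord: "cmod (Rep_ell2 x i) \<le> norm x" for x :: "'a ell2" and i
    using L2_set_le_norm_ell2[of "{i}" x] by simp
  have "Cauchy (\<lambda>n. Rep_ell2 (X n) i)" for i
    unfolding Cauchy_iff
  proof (intro allI impI)
    fix e :: real assume "0 < e"
    with X obtain M where M: "\<forall>m\<ge>M. \<forall>n\<ge>M. norm (X m - X n) < e" unfolding Cauchy_iff by blast
    have "cmod (Rep_ell2 (X m) i - Rep_ell2 (X n) i) < e" if "m \<ge> M" "n \<ge> M" for m n
      using coord[of "X m - X n" i] M[rule_format, OF that] unfolding Rep_ell2_minus by linarith
    then show "\<exists>M. \<forall>m\<ge>M. \<forall>n\<ge>M. cmod (Rep_ell2 (X m) i - Rep_ell2 (X n) i) < e" by blast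
  qed
  then have "\<forall>i. \<exists>l. (\<lambda>n. Rep_ell2 (X n) i) \<longlonglongrightarrow> l"
    by (auto simp: Cauchy_convergent_iff convergent_def)
  then obtain L where L: "\<And>i. (\<lambda>n. Rep_ell2 (X n) i) \<longlonglongrightarrow> L i" by metis
  have tail: "\<exists>M. \<forall>m\<ge>M. \<forall>F. finite F \<longrightarrow> L2_set (\<lambda>i. cmod (Rep_ell2 (X m) i - L i)) F \<le> e"
    if "0 < e" for e
  proof -
    from X that obtain M where M: "\<forall>m\<ge>M. \<forall>n\<ge>M. norm (X m - X n) < e"
      unfolding Cauchy_iff by blast
    have "L2_set (\<lambda>i. cmod (Rep_ell2 (X m) i - L i)) F \<le> e" if "m \<ge> M" "finite F" for m F
    proof (rule LIMSEQ_le_const2)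
      show "(\<lambda>n. L2_set (\<lambda>i. cmod (Rep_ell2 (X m) i - Rep_ell2 (X n) i)) F)
          \<longlonglongrightarrow> L2_set (\<lambda>i. cmod (Rep_ell2 (X m) i - L i)) F"
        unfolding L2_set_def by (intro tendsto_intros L)
      show "\<exists>N. \<forall>n\<ge>N. L2_set (\<lambda>i. cmod (Rep_ell2 (X m) i - Rep_ell2 (X n) i)) F \<le> e"
      proof (intro exI[of _ M] allI impI)
        fix n assume "n \<ge> M"
        then have "norm (X m - X n) \<le> e" using M \<open>m \<ge> M\<close> by (simp add: less_imp_le)
        with L2_set_le_norm_ell2[OF \<open>finite F\<close>, of "X m - X n"]
        show "L2_set (\<lambda>i. cmod (Rep_ell2 (X m) i - Rep_ell2 (X n) i)) F \<le> e"
          unfolding Rep_ell2_minus by linarith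
      qed
    qed
    then show ?thesis by blast
  qed
  obtain m where m: "\<forall>F. finite F \<longrightarrow> L2_set (\<lambda>i. cmod (Rep_ell2 (X m) i - L i)) F \<le> 1"
    using tail[of 1] by auto
  have "L2_set (\<lambda>i. cmod (L i)) F \<le> norm (X m) + 1" if "finite F" for F
  proof -
    have "L2_set (\<lambda>i. cmod (Rep_ell2 (X m) i + (L i - Rep_ell2 (X m) i))) F \<le>
        L2_set (\<lambda>i. cmod (Rep_ell2 (X m) i)) F + L2_set (\<lambda>i. cmod (L i - Rep_ell2 (X m) i)) F"
      by (rule L2_set_norm_triangle)
    also have "L2_set (\<lambda>i. cmod (L i - Rep_ell2 (X m) i)) F \<le> 1"
      using m that by (simp add: norm_minus_commute)
    also have "L2_set (\<lambda>i. cmod (Rep_ell2 (X m) i)) F \<le> norm (X m)"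
      using that by (rule L2_set_le_norm_ell2)
    finally show ?thesis by simp
  qed
  then have "(\<lambda>i. (cmod (L i))\<^sup>2) summable_on UNIV" by (rule L2_set_bounded_summable)
  then have rep: "Rep_ell2 (Abs_ell2 L) = L" by (simp add: Abs_ell2_inverse)
  have "X \<longlonglongrightarrow> Abs_ell2 L"
    unfolding LIMSEQ_iff
  proof (intro allI impI)
    fix e :: real assume "0 < e"
    then obtain M where M: "\<forall>m\<ge>M. \<forall>F. finite F \<longrightarrow> L2_set (\<lambda>i. cmod (Rep_ell2 (X m) i - L i)) F \<le> e / 2"
      using tail[of "e / 2"] by auto
    have "norm (X m - Abs_ell2 L) \<le> e / 2" if "m \<ge> M" for m
      using M that by (intro norm_ell2_leI) (simp add: Rep_ell2_minus rep)
    with \<open>0 < e\<close> show "\<exists>M. \<forall>m\<ge>M. norm (X m - Abs_ell2 L) < e" by force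
  qed
  then show "convergent X" by (auto simp: convergent_def)
qed

end


section \<open>Adjoints and compact operators\<close>

lemma cinner_add_right: "cinner x (y + z) = cinner x y + cinner (x :: 'h :: complex_hilbert) z"
  by (subst (1 2 3) cinner_commute) (simp add: cinner_add_left)

lemma cinner_scaleC_right: "cinner x (c *\<^sub>C y) = cnj c * cinner (x :: 'h :: complex_hilbert) y"
  by (subst (1 2) cinner_commute) (simp add: cinner_scaleC_left)

lemma cinner_scaleR:
  "cinner (r *\<^sub>R x) y = complex_of_real r * cinner (x :: 'h :: complex_hilbert) y"
  "cinner x (r *\<^sub>R y) = complex_of_real r * cinner (x :: 'h :: complex_hilbert) y"
  by (simp_all add: scaleC_of_real[symmetric] cinner_scaleC_left cinner_scaleC_right)

lemma cinner_diff_right: "cinner x (y - z) = cinner x y - cinner (x :: 'h :: complex_hilbert) z"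
  using cinner_add_right[of x "y - z" z] by simp

lemma norm_add_sq:
  "(norm (x + y :: 'h :: complex_hilbert))\<^sup>2 = (norm x)\<^sup>2 + (norm y)\<^sup>2 + 2 * Re (cinner x y)"
proof -
  have "complex_of_real ((norm (x + y))\<^sup>2) = cinner (x + y) (x + y)" by (rule cinner_self[symmetric])
  also have "\<dots> = cinner x x + cinner y y + (cinner x y + cnj (cinner x y))"
    by (simp add: cinner_add_left cinner_add_right cinner_commute[of y x])
  also have "\<dots> = complex_of_real ((norm x)\<^sup>2 + (norm y)\<^sup>2 + 2 * Re (cinner x y))"
    by (simp add: cinner_self complex_add_cnj)
  finally show ?thesis by (simp only: of_real_eq_iff)
qed

lemma Re_cinner_le: "Re (cinner x y) \<le> norm x * norm (y :: 'h :: complex_hilbert)"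
proof -
  have "(norm (x + y))\<^sup>2 \<le> (norm x + norm y)\<^sup>2" by (simp add: norm_triangle_ineq power_mono)
  then show ?thesis by (simp add: norm_add_sq power2_sum)
qed

lemma cmod_cinner_le: "cmod (cinner x y) \<le> norm x * norm (y :: 'h :: complex_hilbert)"
proof (cases "cinner x y = 0")
  case False
  define c where "c = cnj (sgn (cinner x y))"
  have c: "cmod c = 1" using False by (simp add: c_def norm_sgn)
  have "c * cinner x y = cinner x y * cnj (cinner x y) / complex_of_real (cmod (cinner x y))"
    by (simp add: c_def sgn_eq mult.commute)
  also have "\<dots> = complex_of_real (cmod (cinner x y))"
    using False by (simp add: complex_norm_square[symmetric] power2_eq_square)
  finally have "c * cinner x y = complex_of_real (cmod (cinner x y))" .
  then have "cmod (cinner x y) = Re (cinner (c *\<^sub>C x) y)" by (simp add: cinner_scaleC_left)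
  also have "\<dots> \<le> norm (c *\<^sub>C x) * norm y" by (rule Re_cinner_le)
  finally show ?thesis by (simp add: norm_scaleC c)
qed simp

lemma riesz_representation:
  fixes f :: "'h :: complex_hilbert \<Rightarrow>\<^sub>L complex"
  assumes f: "clinear (blinfun_apply f)"
  obtains v where "\<And>x. f x = cinner x v"
proof -
  define J where "J x = (norm x)\<^sup>2 - 2 * Re (f x)" for x
  have Re_le: "Re (f x) \<le> norm f * norm x" for x
    using norm_blinfun[of f x] complex_Re_le_cmod[of "f x"] by linarith
  have low: "- (norm f)\<^sup>2 \<le> J x" for x
    using Re_le[of x] zero_le_power2[of "norm x - norm f"]
    unfolding J_def power2_diff by (simp add: mult_ac)
  define m where "m = Inf (range J)"
  have bdd: "bdd_below (range J)" by (rule bdd_belowI2) (rule low)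
  have m_le: "m \<le> J x" for x unfolding m_def using bdd by (auto intro: cInf_lower)
  have "\<exists>x. J x < m + inverse (real (Suc n))" for n
    using cInf_lessD[of "range J" "m + inverse (real (Suc n))"] by (auto simp: m_def)
  then obtain X where X: "\<And>n. J (X n) < m + inverse (real (Suc n))" by metis
  have par: "(norm (x - y))\<^sup>2 = 2 * J x + 2 * J y - 4 * J ((1/2) *\<^sub>R (x + y))" for x y
  proof -
    have "(norm (x - y))\<^sup>2 = 2 * (norm x)\<^sup>2 + 2 * (norm y)\<^sup>2 - (norm (x + y))\<^sup>2"
      using norm_add_sq[of x y] norm_add_sq[of x "- y"] cinner_scaleR(2)[of x "- 1" y] by simp
    moreover have "4 * J ((1/2) *\<^sub>R (x + y)) = (norm (x + y))\<^sup>2 - 4 * Re (f x) - 4 * Re (f y)"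
      unfolding J_def norm_scaleR blinfun.scaleR_right blinfun.add_right
      by (simp add: power_mult_distrib power_divide field_simps)
    ultimately show ?thesis by (simp add: J_def)
  qed
  have close: "(norm (X a - X b))\<^sup>2 \<le> 2 * inverse (real (Suc a)) + 2 * inverse (real (Suc b))" for a b :: nat
    using X[of a] X[of b] m_le[of "(1/2) *\<^sub>R (X a + X b)"] unfolding par by linarith
  have "Cauchy X"
    unfolding Cauchy_iff
  proof (intro allI impI)
    fix e :: real assume e: "0 < e"
    obtain M where M: "inverse (real (Suc M)) < e\<^sup>2 / 4"
      using reals_Archimedean[of "e\<^sup>2 / 4"] e by auto
    have "norm (X a - X b) < e" if "a \<ge> M" "b \<ge> M" for a b :: nat
    proof -
      have "inverse (real (Suc a)) \<le> inverse (real (Suc M))" "inverse (real (Suc b)) \<le> inverse (real (Suc M))"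
        using that by (auto intro!: le_imp_inverse_le)
      with close[of a b] M have "(norm (X a - X b))\<^sup>2 < e\<^sup>2" by linarith
      then show ?thesis using e by (simp add: power_less_imp_less_base)
    qed
    then show "\<exists>M. \<forall>a\<ge>M. \<forall>b\<ge>M. norm (X a - X b) < e" by blast
  qed
  then obtain v where v: "X \<longlonglongrightarrow> v" by (auto simp: Cauchy_convergent_iff convergent_def)
  have "(\<lambda>n. J (X n)) \<longlonglongrightarrow> J v" unfolding J_def by (intro tendsto_intros v)
  moreover have "(\<lambda>n. m + inverse (real (Suc n))) \<longlonglongrightarrow> m + 0"
    by (intro tendsto_intros LIMSEQ_inverse_real_of_nat)
  ultimately have "J v \<le> m + 0" by (rule LIMSEQ_le) (use X in \<open>auto intro: less_imp_le\<close>)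
  then have Jv: "J v \<le> J x" for x using m_le[of x] by simp
  have re: "Re (f x) = Re (cinner x v)" for x
  proof (rule ccontr)
    define d where "d = Re (f x) - Re (cinner x v)"
    assume "Re (f x) \<noteq> Re (cinner x v)"
    then have d: "d \<noteq> 0" by (simp add: d_def)
    have q: "0 \<le> t\<^sup>2 * (norm x)\<^sup>2 - 2 * t * d" for t
      using Jv[of "v + t *\<^sub>R x"] cinner_commute[of v x]
      by (simp add: J_def norm_add_sq cinner_scaleR blinfun.bilinear_simps d_def
          power_mult_distrib algebra_simps)
    define s where "s = 1 / ((norm x)\<^sup>2 + 1)"
    have p: "0 < (norm x)\<^sup>2 + 1" by (simp add: add_nonneg_pos)
    have s: "0 < s" "s * (norm x)\<^sup>2 \<le> 1" using p by (simp_all add: s_def)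
    have "0 \<le> s * d\<^sup>2 * (s * (norm x)\<^sup>2 - 2)"
      using q[of "s * d"] by (simp add: power2_eq_square algebra_simps)
    moreover have "0 < s * d\<^sup>2" using s d by simp
    ultimately have "0 \<le> s * (norm x)\<^sup>2 - 2" by (simp add: zero_le_mult_iff)
    with s show False by simp
  qed
  have "f x = cinner x v" for x
  proof (rule complex_eqI)
    show "Re (f x) = Re (cinner x v)" by (rule re)
    show "Im (f x) = Im (cinner x v)"
      using re[of "\<i> *\<^sub>C x"] by (simp add: clinear_scaleC[OF f] cinner_scaleC_left scaleC_complex_def)
  qed
  then show ?thesis by (rule that)
qed

text \<open>
  The type \<open>'h \<Rightarrow>\<^sub>L 'h\<close> consists of the bounded real-linear maps, so complex linearity is a
  separate condition. The adjoint exists, and the description below is proper, for complex-linear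
  arguments.
\<close>

definition cadjoint :: "('h :: complex_hilbert \<Rightarrow>\<^sub>L 'h) \<Rightarrow> 'h \<Rightarrow>\<^sub>L 'h"
  where "cadjoint A = (THE B. \<forall>x y. cinner (blinfun_apply A x) y = cinner x (blinfun_apply B y))"

lemma cinner_cadjoint:
  fixes A :: "'h :: complex_hilbert \<Rightarrow>\<^sub>L 'h"
  assumes A: "clinear (blinfun_apply A)"
  shows "cinner (A x) y = cinner x (cadjoint A y)"
proof -
  have "\<exists>v. \<forall>x. cinner (A x) y = cinner x v" for y
  proof -
    have bl: "bounded_linear (\<lambda>x. cinner (A x) y)"
    proof (rule bounded_linear_intro)
      show "cmod (cinner (A x) y) \<le> norm x * (norm A * norm y)" for x
        using cmod_cinner_le[of "A x" y] mult_right_mono[OF norm_blinfun[of A x], of "norm y"]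
        by (simp add: mult_ac)
    qed (simp_all add: blinfun.bilinear_simps cinner_add_left cinner_scaleR scaleR_conv_of_real)
    define f where "f = Blinfun (\<lambda>x. cinner (A x) y)"
    have f: "f x = cinner (A x) y" for x
      unfolding f_def using bl by (simp add: bounded_linear_Blinfun_apply)
    have "clinear (blinfun_apply f)"
      by (rule clinear_blinfunI) (simp add: f clinear_scaleC[OF A] cinner_scaleC_left scaleC_complex_def)
    then obtain v where "\<And>x. f x = cinner x v" using riesz_representation by blast
    then show ?thesis by (auto simp: f)
  qed
  then obtain b where b: "\<And>x y. cinner (A x) y = cinner x (b y)" by metis
  have eqI: "u = v" if "\<And>x. cinner x u = cinner x (v :: 'h)" for u v
    using that[of "u - v"] cinner_self[of "u - v"] by (simp add: cinner_diff_right)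
  have bl: "bounded_linear b"
  proof (rule bounded_linear_intro)
    show "b (y + z) = b y + b z" for y z
      by (rule eqI) (simp add: cinner_add_right flip: b)
    show "b (r *\<^sub>R y) = r *\<^sub>R b y" for r y
      by (rule eqI) (simp add: cinner_scaleR flip: b)
    show "norm (b y) \<le> norm y * norm A" for y
    proof -
      have "(norm (b y))\<^sup>2 = Re (cinner (A (b y)) y)" by (simp add: b cinner_self)
      also have "\<dots> \<le> norm (A (b y)) * norm y" by (rule Re_cinner_le)
      also have "\<dots> \<le> norm A * norm (b y) * norm y" by (intro mult_right_mono norm_blinfun) simp
      finally have "norm (b y) * norm (b y) \<le> norm (b y) * (norm y * norm A)"
        by (simp add: power2_eq_square mult_ac)
      then show ?thesis by (cases "b y = 0") (auto simp: mult_le_cancel_left)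
    qed
  qed
  have "\<forall>x y. cinner (A x) y = cinner x (cadjoint A y)"
    unfolding cadjoint_def
  proof (rule theI)
    show "\<forall>x y. cinner (A x) y = cinner x (Blinfun b y)"
      using bl by (simp add: b bounded_linear_Blinfun_apply)
    show "B = Blinfun b" if "\<forall>x y. cinner (A x) y = cinner x (B y)" for B :: "'h \<Rightarrow>\<^sub>L 'h"
      using that bl by (intro blinfun_eqI eqI) (simp add: bounded_linear_Blinfun_apply flip: b)
  qed
  then show ?thesis by blast
qed

definition compact_ops :: "('h :: complex_hilbert \<Rightarrow>\<^sub>L 'h) set"
  where "compact_ops = {A. clinear (blinfun_apply A) \<and> compact (closure (A ` cball 0 1))}"

lemma compact_opsD: "A \<in> compact_ops \<Longrightarrow> clinear (blinfun_apply A)"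
  by (simp add: compact_ops_def)

lemma compact_closure_subset:
  "compact K \<Longrightarrow> S \<subseteq> K \<Longrightarrow> compact (closure (S :: 'a :: real_normed_vector set))"
  by (metis closed_Int_compact closed_closure closure_minimal compact_imp_closed inf.absorb1)

lemma compact_ops_zero: "0 \<in> compact_ops"
  by (auto simp: compact_ops_def intro!: clinear_blinfunI compact_closure_subset[of "{0}"])

lemma compact_ops_add:
  assumes "A \<in> compact_ops" "B \<in> compact_ops"
  shows "A + B \<in> compact_ops"
proof -
  have "compact {x + y |x y. x \<in> closure (A ` cball 0 1) \<and> y \<in> closure (B ` cball 0 1)}"
    using assms by (intro compact_sums) (auto simp: compact_ops_def)
  moreover have "(A + B) ` cball 0 1 \<subseteq>
      {x + y |x y. x \<in> closure (A ` cball 0 1) \<and> y \<in> closure (B ` cball 0 1)}"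
    using closure_subset[of "A ` cball 0 1"] closure_subset[of "B ` cball 0 1"]
    unfolding blinfun.add_left by blast
  ultimately have "compact (closure ((A + B) ` cball 0 1))" by (rule compact_closure_subset)
  moreover have "clinear (blinfun_apply (A + B))"
    using assms by (intro clinear_blinfunI)
      (simp add: blinfun.add_left clinear_scaleC compact_opsD scaleC_add_right)
  ultimately show ?thesis by (simp add: compact_ops_def)
qed

lemma compact_ops_scaleC:
  assumes "A \<in> compact_ops"
  shows "c *\<^sub>C A \<in> compact_ops"
proof -
  have "compact ((\<lambda>x. c *\<^sub>C x) ` closure (A ` cball 0 1))"
    using assms by (intro compact_continuous_image linear_continuous_on bounded_linear_scaleC)
      (auto simp: compact_ops_def)
  moreover have "(c *\<^sub>C A) ` cball 0 1 \<subseteq> (\<lambda>x. c *\<^sub>C x) ` closure (A ` cball 0 1)"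
    using closure_subset[of "A ` cball 0 1"] by auto
  ultimately have "compact (closure ((c *\<^sub>C A) ` cball 0 1))" by (rule compact_closure_subset)
  moreover have "clinear (blinfun_apply (c *\<^sub>C A))"
    using assms by (intro clinear_blinfunI)
      (simp add: clinear_scaleC compact_opsD scaleC_scaleC mult.commute)
  ultimately show ?thesis by (simp add: compact_ops_def)
qed


section \<open>The standard Hilbert module over the compact operators\<close>

text \<open>
  The partial sums over \<open>F\<close> of the module inner product, and the corresponding seminorms. They are
  only needed to show that the standard module is a normed space.
\<close>

definition gram ::
    "nat set \<Rightarrow> (nat \<Rightarrow> 'h :: complex_hilbert \<Rightarrow>\<^sub>L 'h) \<Rightarrow> (nat \<Rightarrow> 'h \<Rightarrow>\<^sub>L 'h) \<Rightarrow> 'h \<Rightarrow>\<^sub>L 'h"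
  where "gram F x y = (\<Sum>j\<in>F. cadjoint (y j) o\<^sub>L x j)"

definition gnorm :: "nat set \<Rightarrow> (nat \<Rightarrow> 'h :: complex_hilbert \<Rightarrow>\<^sub>L 'h) \<Rightarrow> real"
  where "gnorm F x = sqrt (norm (gram F x x))"

abbreviation cseq :: "(nat \<Rightarrow> 'h :: complex_hilbert \<Rightarrow>\<^sub>L 'h) \<Rightarrow> bool"
  where "cseq x \<equiv> \<forall>j. clinear (blinfun_apply (x j))"

lemma cinner_gram:
  fixes x y :: "nat \<Rightarrow> 'h :: complex_hilbert \<Rightarrow>\<^sub>L 'h"
  assumes "cseq y"
  shows "cinner (gram F x y h) k = (\<Sum>j\<in>F. cinner (x j h) (y j k))"
proof (induction F rule: infinite_finite_induct)
  case (insert j F)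
  have "cinner (cadjoint (y j) (x j h)) k = cinner (x j h) (y j k)"
    using assms cinner_cadjoint[of "y j" k "x j h"]
    by (metis cinner_commute complex_cnj_cancel_iff)
  with insert show ?case
    by (simp add: gram_def blinfun.add_left cinner_add_left)
qed (simp_all add: gram_def cinner_scaleR(1)[of 0 0, simplified])

lemma norm_gram_le:
  fixes x y :: "nat \<Rightarrow> 'h :: complex_hilbert \<Rightarrow>\<^sub>L 'h"
  assumes "cseq y" "0 \<le> a" "0 \<le> b"
    and a: "\<And>h. L2_set (\<lambda>j. norm (x j h)) F \<le> a * norm h"
    and b: "\<And>h. L2_set (\<lambda>j. norm (y j h)) F \<le> b * norm h"
  shows "norm (gram F x y) \<le> a * b"
proof (rule norm_blinfun_bound)
  fix h
  define v where "v = gram F x y h"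
  have "(norm v)\<^sup>2 = Re (cinner v v)" by (simp add: cinner_self)
  also have "\<dots> = (\<Sum>j\<in>F. Re (cinner (x j h) (y j v)))"
    using cinner_gram[OF assms(1), of F x h v] by (simp add: v_def)
  also have "\<dots> \<le> (\<Sum>j\<in>F. \<bar>norm (x j h)\<bar> * \<bar>norm (y j v)\<bar>)"
    by (intro sum_mono) (simp add: Re_cinner_le)
  also have "\<dots> \<le> L2_set (\<lambda>j. norm (x j h)) F * L2_set (\<lambda>j. norm (y j v)) F"
    by (rule L2_set_mult_ineq)
  also have "\<dots> \<le> (a * norm h) * (b * norm v)"
    using assms(2) by (intro mult_mono a b) auto
  finally have "norm v * norm v \<le> norm v * (a * b * norm h)"
    by (simp add: power2_eq_square mult_ac)
  then show "norm (gram F x y h) \<le> a * b * norm h"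
    unfolding v_def[symmetric] using assms(2,3)
    by (cases "v = 0") (auto simp: mult_le_cancel_left)
qed (simp add: assms)

lemma L2_le_gnorm:
  fixes x :: "nat \<Rightarrow> 'h :: complex_hilbert \<Rightarrow>\<^sub>L 'h"
  assumes "cseq x"
  shows "L2_set (\<lambda>j. norm (x j h)) F \<le> gnorm F x * norm h"
proof -
  have "(\<Sum>j\<in>F. (norm (x j h))\<^sup>2) = Re (cinner (gram F x x h) h)"
    using cinner_gram[OF assms, of F x h h] by (simp add: cinner_self)
  also have "\<dots> \<le> norm (gram F x x h) * norm h" by (rule Re_cinner_le)
  also have "\<dots> \<le> norm (gram F x x) * norm h * norm h" by (intro mult_right_mono norm_blinfun) simp
  finally have "L2_set (\<lambda>j. norm (x j h)) F \<le> sqrt (norm (gram F x x) * (norm h)\<^sup>2)"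
    unfolding L2_set_def by (intro real_sqrt_le_mono) (simp add: power2_eq_square mult_ac)
  then show ?thesis by (simp add: gnorm_def real_sqrt_mult)
qed

lemma gnorm_nonneg [simp]: "0 \<le> gnorm F x" by (simp add: gnorm_def)

lemma gnorm_le:
  fixes x :: "nat \<Rightarrow> 'h :: complex_hilbert \<Rightarrow>\<^sub>L 'h"
  assumes "cseq x" "0 \<le> C" "\<And>h. L2_set (\<lambda>j. norm (x j h)) F \<le> C * norm h"
  shows "gnorm F x \<le> C"
  using norm_gram_le[OF assms(1,2,2,3,3)] assms(2)
  by (simp add: gnorm_def real_le_lsqrt power2_eq_square)

lemma norm_gram_le_gnorm: "cseq x \<Longrightarrow> cseq y \<Longrightarrow> norm (gram F x y) \<le> gnorm F x * gnorm F y"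
  by (rule norm_gram_le) (auto intro: L2_le_gnorm)

lemma gnorm_add:
  fixes x y :: "nat \<Rightarrow> 'h :: complex_hilbert \<Rightarrow>\<^sub>L 'h"
  assumes "cseq x" "cseq y" "cseq (\<lambda>j. x j + y j)"
  shows "gnorm F (\<lambda>j. x j + y j) \<le> gnorm F x + gnorm F y"
proof (rule gnorm_le[OF assms(3)])
  fix h
  have "L2_set (\<lambda>j. norm ((x j + y j) h)) F
      \<le> L2_set (\<lambda>j. norm (x j h)) F + L2_set (\<lambda>j. norm (y j h)) F"
    unfolding blinfun.add_left by (rule L2_set_norm_triangle)
  also have "\<dots> \<le> gnorm F x * norm h + gnorm F y * norm h"
    by (intro add_mono L2_le_gnorm assms)
  finally show "L2_set (\<lambda>j. norm ((x j + y j) h)) F \<le> (gnorm F x + gnorm F y) * norm h"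
    by (simp add: distrib_right)
qed simp

lemma gnorm_scaleC_le:
  fixes x :: "nat \<Rightarrow> 'h :: complex_hilbert \<Rightarrow>\<^sub>L 'h"
  assumes "cseq x" "cseq (\<lambda>j. c *\<^sub>C x j)"
  shows "gnorm F (\<lambda>j. c *\<^sub>C x j) \<le> cmod c * gnorm F x"
proof (rule gnorm_le[OF assms(2)])
  fix h
  have "L2_set (\<lambda>j. norm ((c *\<^sub>C x j) h)) F = cmod c * L2_set (\<lambda>j. norm (x j h)) F"
    by (simp add: norm_scaleC L2_set_right_distrib)
  also have "\<dots> \<le> cmod c * (gnorm F x * norm h)"
    by (intro mult_left_mono L2_le_gnorm assms) simp
  finally show "L2_set (\<lambda>j. norm ((c *\<^sub>C x j) h)) F \<le> cmod c * gnorm F x * norm h"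
    by (simp add: mult.assoc)
qed simp

lemma gnorm_mono:
  fixes x :: "nat \<Rightarrow> 'h :: complex_hilbert \<Rightarrow>\<^sub>L 'h"
  assumes "cseq x" "F \<subseteq> G" "finite G"
  shows "gnorm F x \<le> gnorm G x"
proof (rule gnorm_le[OF assms(1)])
  fix h
  have "L2_set (\<lambda>j. norm (x j h)) F \<le> L2_set (\<lambda>j. norm (x j h)) G"
    unfolding L2_set_def using assms by (intro real_sqrt_le_mono sum_mono2) auto
  also have "\<dots> \<le> gnorm G x * norm h" by (rule L2_le_gnorm[OF assms(1)])
  finally show "L2_set (\<lambda>j. norm (x j h)) F \<le> gnorm G x * norm h" .
qed simp

lemma summable_gram_iff:
  fixes x :: "nat \<Rightarrow> 'h :: complex_hilbert \<Rightarrow>\<^sub>L 'h"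
  shows "summable (\<lambda>j. cadjoint (x j) o\<^sub>L x j) \<longleftrightarrow>
    (\<forall>e>0. \<exists>N. \<forall>m\<ge>N. \<forall>n. gnorm {m..<n} x < e)"
  (is "?L \<longleftrightarrow> ?R")
proof -
  have "?L \<longleftrightarrow> (\<forall>e>0. \<exists>N. \<forall>m\<ge>N. \<forall>n. norm (gram {m..<n} x x) < e)"
    by (simp add: summable_Cauchy gram_def)
  also have "\<dots> \<longleftrightarrow> ?R"
  proof (intro iffI allI impI)
    fix e :: real
    assume *: "\<forall>e>0. \<exists>N. \<forall>m\<ge>N. \<forall>n. norm (gram {m..<n} x x) < e" and "0 < e"
    then have "\<exists>N. \<forall>m\<ge>N. \<forall>n. norm (gram {m..<n} x x) < e\<^sup>2" by simp
    then show "\<exists>N. \<forall>m\<ge>N. \<forall>n. gnorm {m..<n} x < e"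
      using \<open>0 < e\<close> real_less_lsqrt[of e] unfolding gnorm_def by (meson less_imp_le)
  next
    fix e :: real
    assume *: "?R" and "0 < e"
    then have "\<exists>N. \<forall>m\<ge>N. \<forall>n. gnorm {m..<n} x < sqrt e" by simp
    then show "\<exists>N. \<forall>m\<ge>N. \<forall>n. norm (gram {m..<n} x x) < e"
      by (simp add: gnorm_def)
  qed
  finally show ?thesis .
qed

typedef (overloaded) 'h std_module =
  "{x :: nat \<Rightarrow> 'h :: complex_hilbert \<Rightarrow>\<^sub>L 'h.
      (\<forall>j. x j \<in> compact_ops) \<and> summable (\<lambda>j. cadjoint (x j) o\<^sub>L x j)}"
  by (rule exI[of _ "\<lambda>_. 0"]) (simp add: compact_ops_zero)

setup_lifting type_definition_std_module

text \<open>
  \<open>module_inner x y\<close> is the sum of \<open>y\<^sub>j\<^sup>* x\<^sub>j\<close>, linear in \<open>x\<close>; the series converges by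
  \<open>module_inner_summable\<close> below.
\<close>

definition module_inner :: "'h :: complex_hilbert std_module \<Rightarrow> 'h std_module \<Rightarrow> 'h \<Rightarrow>\<^sub>L 'h"
  where "module_inner x y = (\<Sum>j. cadjoint (Rep_std_module y j) o\<^sub>L Rep_std_module x j)"

lemma Rep_std_module_compact: "Rep_std_module x j \<in> compact_ops"
  using Rep_std_module[of x] by simp

lemma Rep_std_module_clinear: "cseq (Rep_std_module x)"
  using Rep_std_module_compact compact_opsD by blast

lemma Rep_std_module_summable:
  "summable (\<lambda>j. cadjoint (Rep_std_module x j) o\<^sub>L Rep_std_module x j)"
  using Rep_std_module[of x] by simp

lemma gnorm_tail:
  assumes "0 < e"
  obtains N where "\<And>m n. m \<ge> N \<Longrightarrow> gnorm {m..<n} (Rep_std_module x) < e"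
  using Rep_std_module_summable[of x] assms unfolding summable_gram_iff by meson

lemma module_inner_summable:
  "summable (\<lambda>j. cadjoint (Rep_std_module y j) o\<^sub>L Rep_std_module x j)"
  unfolding summable_Cauchy gram_def[symmetric]
proof (intro allI impI)
  fix e :: real assume e: "0 < e"
  obtain M where M: "\<And>m n. m \<ge> M \<Longrightarrow> gnorm {m..<n} (Rep_std_module x) < sqrt e"
    using gnorm_tail[of "sqrt e"] e by auto
  obtain N where N: "\<And>m n. m \<ge> N \<Longrightarrow> gnorm {m..<n} (Rep_std_module y) < sqrt e"
    using gnorm_tail[of "sqrt e"] e by auto
  have "norm (gram {m..<n} (Rep_std_module x) (Rep_std_module y)) < e" if "m \<ge> max M N" for m n
  proof -
    have "gnorm {m..<n} (Rep_std_module x) * gnorm {m..<n} (Rep_std_module y) < sqrt e * sqrt e"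
      using M[of m n] N[of m n] that by (intro mult_strict_mono') auto
    with norm_gram_le_gnorm[OF Rep_std_module_clinear Rep_std_module_clinear] e show ?thesis
      by (metis less_imp_le order_le_less_trans real_sqrt_mult_self abs_of_nonneg)
  qed
  then show "\<exists>N. \<forall>m\<ge>N. \<forall>n. norm (gram {m..<n} (Rep_std_module x) (Rep_std_module y)) < e" by blast
qed

instantiation std_module :: (complex_hilbert) complex_normed_vector
begin

lift_definition zero_std_module :: "'a std_module" is "\<lambda>_. 0" by (simp add: compact_ops_zero)

lift_definition plus_std_module :: "'a std_module \<Rightarrow> 'a std_module \<Rightarrow> 'a std_module"
  is "\<lambda>x y j. x j + y j"
proof (intro conjI allI)
  fix x y :: "nat \<Rightarrow> 'a \<Rightarrow>\<^sub>L 'a"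
  assume x: "(\<forall>j. x j \<in> compact_ops) \<and> summable (\<lambda>j. cadjoint (x j) o\<^sub>L x j)"
    and y: "(\<forall>j. y j \<in> compact_ops) \<and> summable (\<lambda>j. cadjoint (y j) o\<^sub>L y j)"
  then show c: "x j + y j \<in> compact_ops" for j by (simp add: compact_ops_add)
  have lin: "cseq x" "cseq y" "cseq (\<lambda>j. x j + y j)" using x y c compact_opsD by blast+
  show "summable (\<lambda>j. cadjoint (x j + y j) o\<^sub>L (x j + y j))"
    unfolding summable_gram_iff[of "\<lambda>j. x j + y j"]
  proof (intro allI impI)
    fix e :: real assume "0 < e"
    then have "0 < e / 2" by simp
    with x y obtain M N where M: "\<And>m n. m \<ge> M \<Longrightarrow> gnorm {m..<n} x < e / 2"
      and N: "\<And>m n. m \<ge> N \<Longrightarrow> gnorm {m..<n} y < e / 2"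
      unfolding summable_gram_iff by meson
    have "gnorm {m..<n} (\<lambda>j. x j + y j) < e" if "m \<ge> max M N" for m n
      using gnorm_add[OF lin, of "{m..<n}"] M[of m n] N[of m n] that by simp
    then show "\<exists>N. \<forall>m\<ge>N. \<forall>n. gnorm {m..<n} (\<lambda>j. x j + y j) < e" by blast
  qed
qed

lift_definition scaleC_std_module :: "complex \<Rightarrow> 'a std_module \<Rightarrow> 'a std_module"
  is "\<lambda>c x j. c *\<^sub>C x j"
proof (intro conjI allI)
  fix c :: complex and x :: "nat \<Rightarrow> 'a \<Rightarrow>\<^sub>L 'a"
  assume x: "(\<forall>j. x j \<in> compact_ops) \<and> summable (\<lambda>j. cadjoint (x j) o\<^sub>L x j)"
  then show c: "c *\<^sub>C x j \<in> compact_ops" for j by (simp add: compact_ops_scaleC)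
  have lin: "cseq x" "cseq (\<lambda>j. c *\<^sub>C x j)" using x c compact_opsD by blast+
  show "summable (\<lambda>j. cadjoint (c *\<^sub>C x j) o\<^sub>L (c *\<^sub>C x j))"
    unfolding summable_gram_iff[of "\<lambda>j. c *\<^sub>C x j"]
  proof (intro allI impI)
    fix e :: real assume "0 < e"
    then have "0 < e / (cmod c + 1)" by (simp add: add_nonneg_pos)
    with x obtain M where M: "\<And>m n. m \<ge> M \<Longrightarrow> gnorm {m..<n} x < e / (cmod c + 1)"
      unfolding summable_gram_iff by meson
    have "gnorm {m..<n} (\<lambda>j. c *\<^sub>C x j) < e" if "m \<ge> M" for m n
    proof -
      have p: "0 < cmod c + 1" by (simp add: add_nonneg_pos)
      have "gnorm {m..<n} (\<lambda>j. c *\<^sub>C x j) \<le> cmod c * gnorm {m..<n} x"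
        by (rule gnorm_scaleC_le[OF lin])
      also have "\<dots> \<le> (cmod c + 1) * gnorm {m..<n} x" by (intro mult_right_mono) auto
      also have "\<dots> < e" using M[OF that, of n] p by (simp add: field_simps)
      finally show ?thesis .
    qed
    then show "\<exists>N. \<forall>m\<ge>N. \<forall>n. gnorm {m..<n} (\<lambda>j. c *\<^sub>C x j) < e" by blast
  qed
qed

definition scaleR_std_module :: "real \<Rightarrow> 'a std_module \<Rightarrow> 'a std_module"
  where "scaleR_std_module r x = complex_of_real r *\<^sub>C x"

definition uminus_std_module :: "'a std_module \<Rightarrow> 'a std_module"
  where "uminus_std_module x = (- 1) *\<^sub>C x"

definition minus_std_module :: "'a std_module \<Rightarrow> 'a std_module \<Rightarrow> 'a std_module"
  where "minus_std_module x y = x + - y"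

definition norm_std_module :: "'a std_module \<Rightarrow> real"
  where "norm_std_module x = sqrt (norm (module_inner x x))"

definition sgn_std_module :: "'a std_module \<Rightarrow> 'a std_module"
  where "sgn_std_module x = inverse (norm x) *\<^sub>R x"

definition dist_std_module :: "'a std_module \<Rightarrow> 'a std_module \<Rightarrow> real"
  where "dist_std_module x y = norm (x - y)"

definition uniformity_std_module :: "('a std_module \<times> 'a std_module) filter"
  where "uniformity_std_module = (INF e\<in>{0<..}. principal {(x, y). dist x y < e})"

definition open_std_module :: "'a std_module set \<Rightarrow> bool"
  where "open_std_module U = (\<forall>x\<in>U. \<forall>\<^sub>F (x', y) in uniformity. x' = x \<longrightarrow> y \<in> U)"

instance
proof
  fix x y z :: "'a std_module" and c d :: complex and r s :: real
  have lim: "(\<lambda>n. gnorm {..<n} (Rep_std_module x)) \<longlonglongrightarrow> norm x" for x :: "'a std_module"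
    unfolding gnorm_def gram_def norm_std_module_def module_inner_def
    by (intro tendsto_intros summable_LIMSEQ Rep_std_module_summable)
  have le: "gnorm {..<n} (Rep_std_module x) \<le> norm x" for x :: "'a std_module" and n
    by (rule incseq_le[OF _ lim])
      (auto intro!: monoI gnorm_mono Rep_std_module_clinear[rule_format])
  have nonneg: "0 \<le> norm x" for x :: "'a std_module" by (simp add: norm_std_module_def)
  show "x + y + z = x + (y + z)" "x + y = y + x" "0 + x = x"
    by (transfer; simp add: fun_eq_iff)+
  show "- x + x = 0" unfolding uminus_std_module_def
    by transfer (simp add: fun_eq_iff blinfun_eqI scaleC_of_real[of "-1", simplified])
  show "x - y = x + - y" by (rule minus_std_module_def)
  have addr: "c *\<^sub>C (x + y) = c *\<^sub>C x + c *\<^sub>C y"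
    and addl: "(c + d) *\<^sub>C x = c *\<^sub>C x + d *\<^sub>C x"
    and sc: "c *\<^sub>C d *\<^sub>C x = (c * d) *\<^sub>C x" for c d and x y :: "'a std_module"
    by (transfer; simp add: scaleC_add_right scaleC_add_left scaleC_scaleC)+
  show "c *\<^sub>C (x + y) = c *\<^sub>C x + c *\<^sub>C y" by (rule addr)
  show "(c + d) *\<^sub>C x = c *\<^sub>C x + d *\<^sub>C x" by (rule addl)
  show "c *\<^sub>C d *\<^sub>C x = (c * d) *\<^sub>C x" by (rule sc)
  show "complex_of_real r *\<^sub>C x = r *\<^sub>R x" by (simp add: scaleR_std_module_def)
  have one: "1 *\<^sub>C x = x" for x :: "'a std_module" by transfer simp
  show "r *\<^sub>R (x + y) = r *\<^sub>R x + r *\<^sub>R y" "(r + s) *\<^sub>R x = r *\<^sub>R x + s *\<^sub>R x"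
    "r *\<^sub>R s *\<^sub>R x = (r * s) *\<^sub>R x" "1 *\<^sub>R x = x"
    by (simp_all add: scaleR_std_module_def addr addl sc one)
  have nC_le: "norm (c *\<^sub>C x) \<le> cmod c * norm x" for c and x :: "'a std_module"
  proof (rule LIMSEQ_le_const2[OF lim], intro exI allI impI)
    fix n
    have "gnorm {..<n} (Rep_std_module (c *\<^sub>C x)) \<le> cmod c * gnorm {..<n} (Rep_std_module x)"
      unfolding scaleC_std_module.rep_eq
      by (rule gnorm_scaleC_le[OF Rep_std_module_clinear])
        (use Rep_std_module_clinear[of "c *\<^sub>C x"] in \<open>simp add: scaleC_std_module.rep_eq\<close>)
    also have "\<dots> \<le> cmod c * norm x" by (intro mult_left_mono le) simp
    finally show "gnorm {..<n} (Rep_std_module (c *\<^sub>C x)) \<le> cmod c * norm x" .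
  qed
  have nC: "norm (c *\<^sub>C x) = cmod c * norm x" for c and x :: "'a std_module"
  proof (cases "c = 0")
    case True
    then show ?thesis using nC_le[of 0 x] nonneg[of "0 *\<^sub>C x"] by simp
  next
    case False
    have "norm x \<le> cmod (inverse c) * norm (c *\<^sub>C x)"
      using nC_le[of "inverse c" "c *\<^sub>C x"] False by (simp add: sc one)
    then have "cmod c * norm x \<le> cmod c * (cmod (inverse c) * norm (c *\<^sub>C x))"
      by (intro mult_left_mono) auto
    also have "\<dots> = norm (c *\<^sub>C x)" using False by (simp add: norm_inverse)
    finally show ?thesis using nC_le[of c x] by linarith
  qed
  show "norm (c *\<^sub>C x) = cmod c * norm x" by (rule nC)
  show "norm (r *\<^sub>R x) = \<bar>r\<bar> * norm x" by (simp add: scaleR_std_module_def nC)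
  show "norm (x + y) \<le> norm x + norm y"
  proof (rule LIMSEQ_le_const2[OF lim], intro exI allI impI)
    fix n
    have "gnorm {..<n} (Rep_std_module (x + y))
        \<le> gnorm {..<n} (Rep_std_module x) + gnorm {..<n} (Rep_std_module y)"
      unfolding plus_std_module.rep_eq
      by (rule gnorm_add[OF Rep_std_module_clinear Rep_std_module_clinear])
        (use Rep_std_module_clinear[of "x + y"] in \<open>simp add: plus_std_module.rep_eq\<close>)
    also have "\<dots> \<le> norm x + norm y" by (intro add_mono le)
    finally show "gnorm {..<n} (Rep_std_module (x + y)) \<le> norm x + norm y" .
  qed
  show "norm x = 0 \<longleftrightarrow> x = 0"
  proof
    assume x: "norm x = 0"
    have "Rep_std_module x j h = 0" for j h
    proof -
      have "L2_set (\<lambda>j. norm (Rep_std_module x j h)) {..<Suc j}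
          \<le> gnorm {..<Suc j} (Rep_std_module x) * norm h"
        by (rule L2_le_gnorm[OF Rep_std_module_clinear])
      also have "gnorm {..<Suc j} (Rep_std_module x) = 0"
        using le[of "Suc j" x] gnorm_nonneg[of "{..<Suc j}" "Rep_std_module x"] x by linarith
      finally have "L2_set (\<lambda>j. norm (Rep_std_module x j h)) {..<Suc j} = 0"
        using L2_set_nonneg[of "\<lambda>j. norm (Rep_std_module x j h)" "{..<Suc j}"] by linarith
      then show ?thesis by (simp add: L2_set_eq_0_iff)
    qed
    then have "Rep_std_module x j = 0" for j by (intro blinfun_eqI) simp
    then have "Rep_std_module x = Rep_std_module 0" by (simp add: fun_eq_iff zero_std_module.rep_eq)
    then show "x = 0" by (simp add: Rep_std_module_inject)
  next
    assume "x = 0"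
    then show "norm x = 0"
      by (simp add: norm_std_module_def module_inner_def zero_std_module.rep_eq)
  qed
  show "sgn x = inverse (norm x) *\<^sub>R x" by (rule sgn_std_module_def)
  show "dist x y = norm (x - y)" by (rule dist_std_module_def)
  show "uniformity = (INF e\<in>{0<..}. principal {(x :: 'a std_module, y). dist x y < e})"
    by (rule uniformity_std_module_def)
  show "open U = (\<forall>x\<in>U. \<forall>\<^sub>F (x', y) in uniformity. x' = x \<longrightarrow> y \<in> U)" for U :: "'a std_module set"
    by (rule open_std_module_def)
qed

end


section \<open>Transitivity and cyclicity of operators\<close>

text \<open>
  Sets of pairs carry the subspace topology of the product of the norm topologies; this is the
  topology induced by the maximum of the two norms.
\<close>

definition cstar_transitive :: "('h :: complex_hilbert std_module \<Rightarrow> 'h std_module) \<Rightarrow> bool"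
  where "cstar_transitive T \<longleftrightarrow>
    (\<forall>W U. openin (top_of_set (sphere 0 1 \<times> sphere 0 1)) W \<and> W \<noteq> {} \<and>
           openin (top_of_set compact_ops) U \<and> U \<noteq> {} \<longrightarrow>
      (\<exists>n. \<exists>(x, y)\<in>W. module_inner ((T ^^ n) x) y \<in> U))"

text \<open>
  The dual space is the set of complex-linear elements of \<open>'a \<Rightarrow>\<^sub>L complex\<close>, whose norm is the
  operator norm.
\<close>

definition numerical_pairs :: "('a :: complex_normed_vector \<times> ('a \<Rightarrow>\<^sub>L complex)) set"
  where "numerical_pairs =
    {(x, f). norm x = 1 \<and> clinear (blinfun_apply f) \<and> norm f = 1 \<and> f x = 1}"

definition top_numerically_transitive :: "('a :: complex_normed_vector \<Rightarrow> 'a) \<Rightarrow> bool"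
  where "top_numerically_transitive T \<longleftrightarrow>
    (\<forall>U V. openin (top_of_set numerical_pairs) U \<and> U \<noteq> {} \<and> open V \<and> V \<noteq> {} \<longrightarrow>
      (\<exists>n. \<exists>(x, f)\<in>U. blinfun_apply f ((T ^^ n) x) \<in> V))"

definition eps_cyclic :: "real \<Rightarrow> ('a :: complex_normed_vector \<Rightarrow> 'a) \<Rightarrow> bool"
  where "eps_cyclic \<epsilon> T \<longleftrightarrow>
    (\<exists>x. \<forall>y. \<exists>z\<in>closure (cspan (\<Union>k\<in>{1..}. (T ^^ k) ` cspan {x})). norm (z - y) \<le> \<epsilon> * norm y)"

end

theory Submission
  imports Defs
begin

text \<open>
  Both operators are four times the unilateral shift. Its range is orthogonal to the coordinate
  zero, so no orbit span comes closer than \<open>norm y\<close> to a \<open>y\<close> living in that coordinate.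
  For transitivity, truncate the given vectors at \<open>n\<close> and add entries of size \<open>2\<^sup>-\<^sup>N\<close>, where
  \<open>N = Suc n\<close>, at coordinates \<open>n\<close> and \<open>n + N\<close>. The power \<open>T\<^sup>N\<close> moves the first entry onto the
  second and everything else onto zero entries, and its factor \<open>4\<^sup>N\<close> makes their inner product
  independent of \<open>n\<close>. Over the compact operators the prescribed value \<open>A\<close> is only
  attained approximately, as a product \<open>P A\<close> with a finite-rank projection \<open>P\<close>.
\<close>

section \<open>Sequences and cyclicity in complex normed spaces\<close>

lemma clinearI:
  fixes f :: "'a :: complex_normed_vector \<Rightarrow> 'b :: complex_normed_vector"
  assumes "\<And>x y. f (x + y) = f x + f y" "\<And>c x. f (c *\<^sub>C x) = c *\<^sub>C f x"
  shows "clinear f"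
  using assms by (simp add: Vector_Spaces.linear_iff complex_vector.vector_space_axioms)

lemma clinear_imp_bounded_linear:
  fixes f :: "'a :: complex_normed_vector \<Rightarrow> 'b :: complex_normed_vector"
  assumes "clinear f" "\<And>x. norm (f x) \<le> norm x * K"
  shows "bounded_linear f"
proof (rule bounded_linear_intro)
  show "f (x + y) = f x + f y" for x y
    using assms(1) by (simp add: Vector_Spaces.linear_iff)
  show "f (r *\<^sub>R x) = r *\<^sub>R f x" for r x
    by (simp add: scaleC_of_real[symmetric] clinear_scaleC[OF assms(1)])
qed (rule assms(2))

lemma scaleR_scaleC: "r *\<^sub>R c *\<^sub>C x = c *\<^sub>C r *\<^sub>R (x :: 'a :: complex_normed_vector)"
  by (simp add: scaleC_scaleC mult.commute flip: scaleC_of_real)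

text \<open>The contraction \<open>p\<close> annihilates the range of \<open>T\<close>, hence the
  whole closed orbit span. For \<open>z\<close> in that span,
  \<open>norm y = norm (p (z - y))\<close> is at most \<open>norm (z - y)\<close>, which rules out
  any relative error below 1. The codomain of \<open>p\<close> is left general because coordinates
  are scalars in one application and operators in the other.\<close>

lemma not_eps_cyclicI:
  fixes T :: "'a :: complex_normed_vector \<Rightarrow> 'a" and p :: "'a \<Rightarrow> 'b :: complex_normed_vector"
  assumes p: "clinear p" "\<And>x. norm (p x) \<le> norm x" "\<And>x. p (T x) = 0"
    and y: "norm (p y) = norm y" "y \<noteq> 0" and eps: "\<epsilon> < 1"
  shows "\<not> eps_cyclic \<epsilon> T"
proof
  assume "eps_cyclic \<epsilon> T"
  then obtain x z where z: "z \<in> closure (cspan (\<Union>k\<in>{1..}. (T ^^ k) ` cspan {x}))"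
    and le: "norm (z - y) \<le> \<epsilon> * norm y"
    unfolding eps_cyclic_def by blast
  have bl: "bounded_linear p" using p by (intro clinear_imp_bounded_linear[where K = 1]) auto
  then have lin: "linear p" by (rule bounded_linear.linear)
  \<comment> \<open>The orbit in \<open>eps_cyclic\<close> starts at \<open>k = 1\<close>, so every
    generator lies in the range of \<open>T\<close>.\<close>
  have "(T ^^ k) u \<in> {z. p z = 0}" if "1 \<le> k" for k u
    using that p(3) by (cases k) auto
  moreover have "complex_vector.subspace {z. p z = 0}"
    using p(1) by (intro complex_vector.subspaceI)
      (auto simp: clinear_scaleC Vector_Spaces.linear_iff linear_0[OF lin])
  ultimately have "cspan (\<Union>k\<in>{1..}. (T ^^ k) ` cspan {x}) \<subseteq> {z. p z = 0}"
    by (intro complex_vector.span_minimal) auto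
  moreover have "closed {z. p z = 0}"
    by (intro closed_Collect_eq bounded_linear.continuous_on[OF bl] continuous_intros)
  ultimately have "p z = 0" using z closure_minimal by blast
  then have "norm y = norm (p (z - y))" by (simp add: linear_diff[OF lin] y)
  also have "\<dots> \<le> \<epsilon> * norm y" using p(2) le by (rule order_trans)
  finally show False using y eps by simp
qed

lemma eventually_norm_sgn:
  fixes X :: "nat \<Rightarrow> 'a :: real_normed_vector"
  assumes "X \<longlonglongrightarrow> x" "x \<noteq> 0"
  shows "\<forall>\<^sub>F n in sequentially. norm (sgn (X n)) = 1"
  using tendsto_imp_eventually_ne[OF assms] by eventually_elim (simp add: norm_sgn)

text \<open>Here \<open>sgn\<close> is normalisation: it is continuous away from zero and fixes unit
  vectors, so perturbed vectors return to the unit sphere with the same limit.\<close>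

lemma tendsto_sgn_unit:
  fixes X :: "nat \<Rightarrow> 'a :: real_normed_vector"
  assumes "X \<longlonglongrightarrow> x" "norm x = 1"
  shows "(\<lambda>n. sgn (X n)) \<longlonglongrightarrow> x"
proof -
  have "x \<noteq> 0" using assms(2) by auto
  then show ?thesis using tendsto_sgn[OF assms(1)] assms(2) by (simp add: sgn_div_norm)
qed

text \<open>Relative openness only controls sequences that stay in \<open>S\<close>; the
  approximants are normalised to meet this condition.\<close>

lemma eventually_openin:
  assumes "openin (top_of_set S) W" "x \<in> W" "X \<longlonglongrightarrow> x" "\<forall>\<^sub>F n in sequentially. X n \<in> S"
  shows "\<forall>\<^sub>F n in sequentially. X n \<in> W"
proof -
  obtain G where G: "open G" "W = S \<inter> G" using assms(1) by (auto simp: openin_open)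
  have "\<forall>\<^sub>F n in sequentially. X n \<in> G"
    by (rule topological_tendstoD[OF assms(3) G(1)]) (use assms(2) G in auto)
  with assms(4) show ?thesis by eventually_elim (simp add: G)
qed

text \<open>This makes the entries added at moving coordinates vanish in the limit. The exponent is
  \<open>Suc n\<close> to match the power of the operator applied at stage \<open>n\<close>.\<close>

lemma tendsto_inverse_power2_scaleR:
  fixes a :: "'a :: real_normed_vector"
  assumes "\<And>n. norm (X n) \<le> K"
  shows "(\<lambda>n. ((1/2) ^ Suc n :: real) *\<^sub>R (X n :: 'a)) \<longlonglongrightarrow> 0"
proof (rule Lim_null_comparison)
  show "\<forall>\<^sub>F n in sequentially. norm ((1/2) ^ Suc n *\<^sub>R X n) \<le> (1/2) ^ Suc n * K"
    by (rule always_eventually) (auto simp: assms intro!: mult_left_mono)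
  have "(\<lambda>n. (1/2) ^ Suc n * K) \<longlonglongrightarrow> 0 * K"
    by (intro tendsto_mult tendsto_const LIMSEQ_Suc LIMSEQ_power_zero) simp
  then show "(\<lambda>n. (1/2) ^ Suc n * K) \<longlonglongrightarrow> 0" by simp
qed


section \<open>The shift on square-summable sequences\<close>

lemma Rep_ell2_scaleR: "Rep_ell2 (r *\<^sub>R x) i = r *\<^sub>R Rep_ell2 x i"
  by (simp add: scaleR_ell2_def scaleC_ell2.rep_eq scaleR_conv_of_real)

lemma Rep_ell2_sgn: "Rep_ell2 (sgn x) i = inverse (norm x) *\<^sub>R Rep_ell2 x i"
  by (simp add: sgn_div_norm Rep_ell2_scaleR)

lemma has_sum_shift:
  assumes "f 0 = 0"
  shows "(f has_sum s) (UNIV :: nat set) \<longleftrightarrow> ((\<lambda>i. f (Suc i)) has_sum s) UNIV"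
proof -
  have "(f has_sum s) UNIV \<longleftrightarrow> (f has_sum s) (range Suc)"
    by (rule has_sum_cong_neutral) (auto simp: assms image_iff, metis assms not0_implies_Suc)
  also have "\<dots> \<longleftrightarrow> ((f \<circ> Suc) has_sum s) UNIV"
    by (rule has_sum_reindex) simp
  finally show ?thesis by (simp add: o_def)
qed

lift_definition ell2_shift :: "nat ell2 \<Rightarrow> nat ell2"
  is "\<lambda>x i. case i of 0 \<Rightarrow> 0 | Suc j \<Rightarrow> x j"
  unfolding summable_on_def by (simp add: has_sum_shift)

lemma norm_ell2_shift: "norm (ell2_shift x) = norm x"
proof transfer
  fix x :: "nat \<Rightarrow> complex"
  assume "(\<lambda>i. (cmod (x i))\<^sup>2) summable_on UNIV"
  then have "((\<lambda>i. (cmod (case i of 0 \<Rightarrow> 0 | Suc j \<Rightarrow> x j))\<^sup>2) has_sum (\<Sum>\<^sub>\<infinity>i. (cmod (x i))\<^sup>2)) UNIV"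
    by (simp add: has_sum_shift)
  then show "sqrt (\<Sum>\<^sub>\<infinity>i. (cmod (case i of 0 \<Rightarrow> 0 | Suc j \<Rightarrow> x j))\<^sup>2) = sqrt (\<Sum>\<^sub>\<infinity>i. (cmod (x i))\<^sup>2)"
    by (simp add: infsumI)
qed

definition ell2_shift4 :: "nat ell2 \<Rightarrow> nat ell2" where "ell2_shift4 x = 4 *\<^sub>C ell2_shift x"

lemma Rep_ell2_shift4_pow:
  "Rep_ell2 ((ell2_shift4 ^^ N) x) i = (if i < N then 0 else 4 ^ N * Rep_ell2 x (i - N))"
  by (induction N arbitrary: i)
    (auto simp: ell2_shift4_def scaleC_ell2.rep_eq ell2_shift.rep_eq split: nat.split)

lemma bounded_clinear_ell2_shift4: "bounded_clinear ell2_shift4"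
  unfolding bounded_clinear_def
proof (intro conjI exI allI)
  show "clinear ell2_shift4"
    unfolding ell2_shift4_def
    by (rule clinearI; transfer; auto simp: fun_eq_iff algebra_simps split: nat.split)
  show "norm (ell2_shift4 x) \<le> 4 * norm x" for x
    by (simp add: ell2_shift4_def norm_scaleC norm_ell2_shift)
qed

section \<open>Truncations and single entries in \<open>ell2\<close>\<close>

lift_definition ell2_trunc :: "nat \<Rightarrow> nat ell2 \<Rightarrow> nat ell2" is "\<lambda>n x i. if i < n then x i else 0"
proof -
  fix n and x :: "nat \<Rightarrow> complex"
  have "(\<lambda>i. (cmod (if i < n then x i else 0))\<^sup>2) summable_on UNIV \<longleftrightarrow>
    (\<lambda>i. (cmod (x i))\<^sup>2) summable_on {..<n}"
    by (rule summable_on_cong_neutral) auto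
  then show "(\<lambda>i. (cmod (if i < n then x i else 0))\<^sup>2) summable_on UNIV" by simp
qed

lift_definition ell2_single :: "nat \<Rightarrow> complex \<Rightarrow> nat ell2" is "\<lambda>k c i. if i = k then c else 0"
proof -
  fix k :: nat and c :: complex
  have "(\<lambda>i. (cmod (if i = k then c else 0))\<^sup>2) summable_on UNIV \<longleftrightarrow>
    (\<lambda>i. (cmod c)\<^sup>2) summable_on {k}"
    by (rule summable_on_cong_neutral) auto
  then show "(\<lambda>i. (cmod (if i = k then c else 0))\<^sup>2) summable_on UNIV" by simp
qed

lemma norm_ell2_single: "norm (ell2_single k c) = cmod c"
proof transfer
  fix k :: nat and c :: complex
  have "(\<Sum>\<^sub>\<infinity>i. (cmod (if i = k then c else 0))\<^sup>2) = (\<Sum>\<^sub>\<infinity>i\<in>{k}. (cmod c)\<^sup>2)"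
    by (rule infsum_cong_neutral) auto
  then show "sqrt (\<Sum>\<^sub>\<infinity>i. (cmod (if i = k then c else 0))\<^sup>2) = cmod c" by simp
qed

text \<open>The squared distance is the tail of the convergent series of squared moduli.\<close>

lemma ell2_trunc_tendsto: "(\<lambda>n. ell2_trunc n x) \<longlonglongrightarrow> x"
proof -
  define f where "f i = (cmod (Rep_ell2 x i))\<^sup>2" for i
  have f: "f summable_on UNIV" unfolding f_def by (rule summable_Rep_ell2)
  have eq: "norm (ell2_trunc n x - x) = sqrt (infsum f UNIV - sum f {..<n})" for n
  proof -
    have "(\<Sum>\<^sub>\<infinity>i. (cmod (Rep_ell2 (ell2_trunc n x - x) i))\<^sup>2) = infsum f (UNIV - {..<n})"
      by (rule infsum_cong_neutral) (auto simp: f_def Rep_ell2_minus ell2_trunc.rep_eq)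
    also have "\<dots> = infsum f UNIV - sum f {..<n}"
      using f by (subst infsum_Diff) auto
    finally show ?thesis by (simp add: norm_ell2.rep_eq)
  qed
  have "(\<lambda>n. sum f {..<n}) \<longlonglongrightarrow> infsum f UNIV"
    using has_sum_imp_sums[OF has_sum_infsum[OF f]] by (simp add: sums_def)
  then have "(\<lambda>n. sqrt (infsum f UNIV - sum f {..<n})) \<longlonglongrightarrow> sqrt (infsum f UNIV - infsum f UNIV)"
    by (intro tendsto_intros)
  then have "(\<lambda>n. norm (ell2_trunc n x - x)) \<longlonglongrightarrow> 0" by (simp add: eq)
  then show ?thesis by (metis LIM_zero_cancel tendsto_norm_zero_iff)
qed

lemma clinear_Rep_ell2: "clinear (\<lambda>x. Rep_ell2 x i)"
  by (rule clinearI) (simp_all add: plus_ell2.rep_eq scaleC_ell2.rep_eq scaleC_complex_def)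

lemma not_eps_cyclic_ell2_shift4: "\<epsilon> < 1 \<Longrightarrow> \<not> eps_cyclic \<epsilon> ell2_shift4"
proof (rule not_eps_cyclicI[OF clinear_Rep_ell2])
  show "cmod (Rep_ell2 x 0) \<le> norm x" for x :: "nat ell2"
    using L2_set_le_norm_ell2[of "{0}" x] by simp
  show "Rep_ell2 (ell2_shift4 x) 0 = 0" for x using Rep_ell2_shift4_pow[of 1 x 0] by simp
  show "cmod (Rep_ell2 (ell2_single 0 1) 0) = norm (ell2_single 0 1)"
    by (simp add: norm_ell2_single ell2_single.rep_eq)
  show "ell2_single 0 1 \<noteq> 0" using norm_ell2_single[of 0 1] by auto
qed

section \<open>Norming functionals on a Hilbert space\<close>

lift_definition cinner_functional :: "'h :: complex_hilbert \<Rightarrow> 'h \<Rightarrow>\<^sub>L complex" is "\<lambda>y x. cinner x y"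
proof (rule bounded_linear_intro)
  show "cmod (cinner x y) \<le> norm x * norm y" for x y :: 'h by (rule cmod_cinner_le)
qed (simp_all add: cinner_add_left cinner_scaleR scaleR_conv_of_real)

lemma cinner_functional_diff: "cinner_functional x - cinner_functional y = cinner_functional (x - y)"
  by (rule blinfun_eqI) (simp add: blinfun.diff_left cinner_functional.rep_eq cinner_diff_right)

lemma norm_cinner_functional_le: "norm (cinner_functional x) \<le> norm x"
  by (rule norm_blinfun_bound) (simp_all add: cinner_functional.rep_eq cmod_cinner_le mult.commute)

lemma tendsto_cinner_functional:
  assumes "X \<longlonglongrightarrow> x" shows "(\<lambda>n. cinner_functional (X n)) \<longlonglongrightarrow> cinner_functional x"
proof -
  have "(\<lambda>n. cinner_functional (X n) - cinner_functional x) \<longlonglongrightarrow> 0"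
    by (rule Lim_null_comparison[where g = "\<lambda>n. norm (X n - x)"])
      (use assms in \<open>simp_all add: cinner_functional_diff norm_cinner_functional_le LIM_zero
        tendsto_norm_zero\<close>)
  then show ?thesis by (rule LIM_zero_cancel)
qed

text \<open>This is the equality case of the Cauchy-Schwarz inequality: a unit vector has exactly
  one norming functional, the one it represents itself. Perturbing a pair thus amounts to perturbing
  one unit vector.\<close>

lemma numerical_pairs_hilbert:
  "numerical_pairs = {(x :: 'h :: complex_hilbert, cinner_functional x) |x. norm x = 1}"
proof (intro equalityI subsetI; clarify)
  fix x :: 'h and f
  assume "(x, f) \<in> numerical_pairs"
  then have f: "norm x = 1" "clinear (blinfun_apply f)" "norm f = 1" "f x = 1"
    by (auto simp: numerical_pairs_def)
  obtain v where v: "\<And>x. f x = cinner x v" using riesz_representation[OF f(2)] by blast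
  \<comment> \<open>Testing \<open>f\<close> on its own Riesz vector gives
    \<open>norm v \<le> 1\<close>; expanding the square of \<open>norm (x - v)\<close> with
    \<open>cinner x v = 1\<close> then forces \<open>x = v\<close>.\<close>
  have "(norm v)\<^sup>2 \<le> norm v"
    using norm_blinfun[of f v] f(3) by (simp add: v cinner_self norm_power)
  then have "norm v * norm v \<le> norm v * 1" by (simp add: power2_eq_square)
  then have "norm v \<le> 1" by (cases "v = 0") (auto simp: mult_le_cancel_left)
  then have "(norm v)\<^sup>2 \<le> 1" by (simp add: power_le_one)
  moreover have "Re (cinner x (- v)) = - 1"
    using v[of x] f(4) cinner_scaleR(2)[of x "- 1" v] by simp
  ultimately have "(norm (x + - v))\<^sup>2 \<le> 0" unfolding norm_add_sq using f(1) by simp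
  then have "x = v" by simp
  then have "f = cinner_functional x" by (intro blinfun_eqI) (simp add: v cinner_functional.rep_eq)
  then show "\<exists>x'. (x, f) = (x', cinner_functional x') \<and> norm x' = 1" using f(1) by blast
next
  fix x :: 'h
  assume x: "norm x = 1"
  have one: "cinner_functional x x = 1"
    using x by (simp add: cinner_functional.rep_eq cinner_self)
  then have "1 \<le> norm (cinner_functional x)"
    using norm_blinfun[of "cinner_functional x" x] x by simp
  then have "norm (cinner_functional x) = 1" using norm_cinner_functional_le[of x] x by simp
  moreover have "clinear (blinfun_apply (cinner_functional x))"
    by (rule clinear_blinfunI)
      (simp add: cinner_functional.rep_eq cinner_scaleC_left scaleC_complex_def)
  ultimately show "(x, cinner_functional x) \<in> numerical_pairs"
    using one x by (simp add: numerical_pairs_def)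
qed

lemma top_numerically_transitive_ell2_shift4: "top_numerically_transitive ell2_shift4"
  unfolding top_numerically_transitive_def
proof (intro allI impI, elim conjE)
  fix U :: "(nat ell2 \<times> (nat ell2 \<Rightarrow>\<^sub>L complex)) set" and V :: "complex set"
  assume U: "openin (top_of_set numerical_pairs) U" "U \<noteq> {}" and V: "open V" "V \<noteq> {}"
  obtain c where c: "c \<in> V" using V by blast
  obtain x where x: "(x, cinner_functional x) \<in> U" "norm x = 1"
    using U openin_imp_subset[OF U(1)] unfolding numerical_pairs_hilbert by blast
  \<comment> \<open>The functional comes from the same vector, so both added entries go into one
    \<open>X n\<close>: the target \<open>c\<close> at \<open>n\<close>, and 1 at the coordinate
    that \<open>n\<close> is shifted to.\<close>
  define X where "X n = ell2_trunc n x + (1/2) ^ Suc n *\<^sub>R ell2_single n c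
    + (1/2) ^ Suc n *\<^sub>R ell2_single (n + Suc n) 1" for n
  have "X \<longlonglongrightarrow> x + 0 + 0"
    unfolding X_def
    by (intro tendsto_add ell2_trunc_tendsto tendsto_inverse_power2_scaleR[where K = "cmod c"]
        tendsto_inverse_power2_scaleR[where K = 1])
      (simp_all add: norm_ell2_single)
  then have X: "X \<longlonglongrightarrow> x" by simp
  have "x \<noteq> 0" using x(2) by auto
  have lim: "(\<lambda>n. (sgn (X n), cinner_functional (sgn (X n)))) \<longlonglongrightarrow> (x, cinner_functional x)"
    using X x(2) by (intro tendsto_Pair tendsto_cinner_functional tendsto_sgn_unit)
  have "\<forall>\<^sub>F n in sequentially. (sgn (X n), cinner_functional (sgn (X n))) \<in> numerical_pairs"
    using eventually_norm_sgn[OF X \<open>x \<noteq> 0\<close>]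
    by eventually_elim (auto simp: numerical_pairs_hilbert)
  then have inU: "\<forall>\<^sub>F n in sequentially. (sgn (X n), cinner_functional (sgn (X n))) \<in> U"
    by (rule eventually_openin[OF U(1) x(1) lim])
  have inner: "cinner ((ell2_shift4 ^^ Suc n) (sgn (X n))) (sgn (X n)) =
      (inverse (norm (X n)))\<^sup>2 *\<^sub>R c" for n
  proof -
    let ?m = "n + Suc n"
    \<comment> \<open>\<open>X n\<close> lives on the coordinates up to \<open>n\<close> and on
      \<open>?m\<close>. After the shift by \<open>Suc n\<close> it lives on those from
      \<open>Suc n\<close> to \<open>?m\<close> and on \<open>?m + Suc n\<close>. Only
      \<open>?m\<close> is common.\<close>
    have "cinner ((ell2_shift4 ^^ Suc n) (sgn (X n))) (sgn (X n)) =
      (\<Sum>\<^sub>\<infinity>i\<in>{?m}. Rep_ell2 ((ell2_shift4 ^^ Suc n) (sgn (X n))) i * cnj (Rep_ell2 (sgn (X n)) i))"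
      unfolding cinner_ell2_def
      by (rule infsum_cong_neutral)
        (auto simp: Rep_ell2_shift4_pow X_def Rep_ell2_sgn plus_ell2.rep_eq Rep_ell2_scaleR
          ell2_trunc.rep_eq ell2_single.rep_eq simp del: funpow.simps)
    \<comment> \<open>The operator contributes \<open>4 ^ Suc n\<close>, each added entry
      \<open>(1/2) ^ Suc n\<close>, and each normalisation one inverse norm.\<close>
    also have "\<dots> = (inverse (norm (X n)))\<^sup>2 *\<^sub>R ((4 * (1/2) * (1/2)) ^ Suc n * c)"
      unfolding power_mult_distrib
      by (simp add: Rep_ell2_shift4_pow X_def Rep_ell2_sgn plus_ell2.rep_eq Rep_ell2_scaleR
          ell2_trunc.rep_eq ell2_single.rep_eq scaleR_conv_of_real power2_eq_square
          del: funpow.simps)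
    finally show ?thesis by simp
  qed
  \<comment> \<open>The limit is \<open>c\<close> itself, since \<open>norm x = 1\<close>.\<close>
  have "(\<lambda>n. (inverse (norm (X n)))\<^sup>2 *\<^sub>R c) \<longlonglongrightarrow> (inverse (norm x))\<^sup>2 *\<^sub>R c"
    using \<open>x \<noteq> 0\<close> by (intro tendsto_intros X) auto
  then have "\<forall>\<^sub>F n in sequentially. (inverse (norm (X n)))\<^sup>2 *\<^sub>R c \<in> V"
    using V(1) c x(2) by (auto intro: topological_tendstoD)
  with inU have "\<forall>\<^sub>F n in sequentially. (sgn (X n), cinner_functional (sgn (X n))) \<in> U \<and>
      cinner_functional (sgn (X n)) ((ell2_shift4 ^^ Suc n) (sgn (X n))) \<in> V"
    by eventually_elim (simp only: inner cinner_functional.rep_eq simp_thms)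
  then obtain n where "(sgn (X n), cinner_functional (sgn (X n))) \<in> U"
    "cinner_functional (sgn (X n)) ((ell2_shift4 ^^ Suc n) (sgn (X n))) \<in> V"
    using eventually_happens'[OF sequentially_bot] by blast
  then show "\<exists>n. \<exists>(x, f)\<in>U. blinfun_apply f ((ell2_shift4 ^^ n) x) \<in> V" by blast
qed


section \<open>Approximation of compact operators\<close>

lemma cinner_zero_left [simp]: "cinner 0 (x :: 'h :: complex_hilbert) = 0"
  using cinner_scaleR(1)[of 0 0 x] by simp

lemma cinner_zero_right [simp]: "cinner (x :: 'h :: complex_hilbert) 0 = 0"
  using cinner_scaleR(2)[of x 0 0] by simp

lemma cinner_right_eqI:
  fixes u v :: "'h :: complex_hilbert"
  assumes "\<And>x. cinner x u = cinner x v" shows "u = v"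
  using assms[of "u - v"] cinner_self[of "u - v"] by (simp add: cinner_diff_right)

lemma cadjoint_eqI:
  fixes A B :: "'h :: complex_hilbert \<Rightarrow>\<^sub>L 'h"
  assumes "clinear (blinfun_apply A)" "\<And>x y. cinner (A x) y = cinner x (B y)"
  shows "cadjoint A = B"
  using assms by (intro blinfun_eqI cinner_right_eqI) (simp flip: cinner_cadjoint)

lemma cadjoint_zero: "cadjoint (0 :: 'h :: complex_hilbert \<Rightarrow>\<^sub>L 'h) = 0"
  by (intro cadjoint_eqI compact_opsD[OF compact_ops_zero]) simp

lemma cadjoint_scaleR:
  fixes A :: "'h :: complex_hilbert \<Rightarrow>\<^sub>L 'h"
  assumes "clinear (blinfun_apply A)" shows "cadjoint (r *\<^sub>R A) = r *\<^sub>R cadjoint A"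
  using assms
  by (intro cadjoint_eqI clinear_blinfunI)
    (simp_all add: blinfun.scaleR_left cinner_scaleR cinner_cadjoint clinear_scaleC scaleR_scaleC)

lemma compact_ops_scaleR: "A \<in> compact_ops \<Longrightarrow> r *\<^sub>R A \<in> compact_ops"
  using compact_ops_scaleC[of A "complex_of_real r"] by (simp add: scaleC_of_real)

lemma compact_ops_compose_right:
  fixes A B :: "'h :: complex_hilbert \<Rightarrow>\<^sub>L 'h"
  assumes A: "A \<in> compact_ops" and B: "clinear (blinfun_apply B)"
  shows "B o\<^sub>L A \<in> compact_ops"
proof -
  have "compact (B ` closure (A ` cball 0 1))"
    using A by (intro compact_continuous_image linear_continuous_on blinfun.bounded_linear_right)
      (auto simp: compact_ops_def)
  moreover have "(B o\<^sub>L A) ` cball 0 1 \<subseteq> B ` closure (A ` cball 0 1)"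
    using closure_subset[of "A ` cball 0 1"] by auto
  ultimately have "compact (closure ((B o\<^sub>L A) ` cball 0 1))" by (rule compact_closure_subset)
  moreover have "clinear (blinfun_apply (B o\<^sub>L A))"
    using A B by (intro clinear_blinfunI) (simp add: clinear_scaleC compact_opsD)
  ultimately show ?thesis by (simp add: compact_ops_def)
qed

section \<open>Rank-one operators and finite-rank projections\<close>

lift_definition rank_one :: "'h :: complex_hilbert \<Rightarrow> 'h \<Rightarrow>\<^sub>L 'h" is "\<lambda>v x. cinner x v *\<^sub>C v"
proof (rule bounded_linear_intro)
  fix v x :: 'h
  show "norm (cinner x v *\<^sub>C v) \<le> norm x * (norm v * norm v)"
    using mult_right_mono[OF cmod_cinner_le[of x v], of "norm v"]
    by (simp add: norm_scaleC mult.assoc)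
next
  fix v x :: 'h and r :: real
  show "cinner (r *\<^sub>R x) v *\<^sub>C v = r *\<^sub>R cinner x v *\<^sub>C v"
    by (simp add: cinner_scaleR scaleC_scaleC scaleC_of_real[of r "cinner x v *\<^sub>C v", symmetric])
qed (simp add: cinner_add_left scaleC_add_left)

text \<open>The unit ball is mapped into the image of a closed disc of scalars under
  \<open>c \<mapsto> c *\<^sub>C v\<close>, which is compact.\<close>

lemma compact_ops_rank_one: "rank_one v \<in> compact_ops"
proof -
  have "rank_one v ` cball 0 1 \<subseteq> (\<lambda>c. c *\<^sub>C v) ` cball 0 (norm v)"
  proof clarify
    fix x :: 'a assume "x \<in> cball 0 1"
    then have "cmod (cinner x v) \<le> norm v"
      using cmod_cinner_le[of x v] mult_right_mono[of "norm x" 1 "norm v"] by simp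
    then show "rank_one v x \<in> (\<lambda>c. c *\<^sub>C v) ` cball 0 (norm v)"
      by (auto simp: rank_one.rep_eq)
  qed
  moreover have "bounded_linear (\<lambda>c. c *\<^sub>C v)"
    by (rule bounded_linear_intro[where K = "norm v"])
      (simp_all add: scaleC_add_left scaleR_conv_of_real scaleC_scaleC norm_scaleC
        flip: scaleC_of_real)
  then have "compact ((\<lambda>c. c *\<^sub>C v) ` cball 0 (norm v))"
    by (intro compact_continuous_image linear_continuous_on compact_cball)
  ultimately have "compact (closure (rank_one v ` cball 0 1))" by (intro compact_closure_subset)
  moreover have "clinear (blinfun_apply (rank_one v))"
    by (rule clinear_blinfunI) (simp add: rank_one.rep_eq cinner_scaleC_left scaleC_scaleC)
  ultimately show ?thesis by (simp add: compact_ops_def)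
qed

definition finite_proj :: "('i \<Rightarrow> 'h :: complex_hilbert) \<Rightarrow> 'i set \<Rightarrow> 'h \<Rightarrow>\<^sub>L 'h"
  where "finite_proj e F = (\<Sum>i\<in>F. rank_one (e i))"

lemma compact_ops_finite_proj: "finite_proj e F \<in> compact_ops"
  unfolding finite_proj_def
  by (induction F rule: infinite_finite_induct)
    (auto simp: compact_ops_zero compact_ops_add compact_ops_rank_one)

lemma finite_proj_apply: "finite_proj e F x = (\<Sum>i\<in>F. cinner x (e i) *\<^sub>C e i)"
  unfolding finite_proj_def
  by (induction F rule: infinite_finite_induct) (auto simp: blinfun.add_left rank_one.rep_eq)

lemma cinner_sum_left: "cinner (\<Sum>i\<in>F. f i) (y :: 'h :: complex_hilbert) = (\<Sum>i\<in>F. cinner (f i) y)"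
  by (induction F rule: infinite_finite_induct) (auto simp: cinner_add_left)

lemma cinner_sum_right: "cinner (y :: 'h :: complex_hilbert) (\<Sum>i\<in>F. f i) = (\<Sum>i\<in>F. cinner y (f i))"
  by (induction F rule: infinite_finite_induct) (auto simp: cinner_add_right)

lemma cadjoint_finite_proj: "cadjoint (finite_proj e F) = finite_proj e F"
proof (rule cadjoint_eqI[OF compact_opsD[OF compact_ops_finite_proj]])
  show "cinner (finite_proj e F x) y = cinner x (finite_proj e F y)" for x y
    unfolding finite_proj_apply cinner_sum_left cinner_sum_right cinner_scaleC_left
      cinner_scaleC_right
    by (rule sum.cong) (simp_all add: cinner_commute[of "e _" y] mult.commute)
qed

lemma finite_proj_idem:
  assumes "\<And>i j. cinner (e i) (e j) = (if i = j then 1 else 0)" "finite F"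
  shows "finite_proj e F (finite_proj e F x) = finite_proj e F x"
proof -
  have "cinner (finite_proj e F x) (e i) = cinner x (e i)" if "i \<in> F" for i
  proof -
    have "cinner (finite_proj e F x) (e i) = (\<Sum>j\<in>F. if j = i then cinner x (e i) else 0)"
      unfolding finite_proj_apply cinner_sum_left cinner_scaleC_left
      by (rule sum.cong) (auto simp: assms(1))
    then show ?thesis using assms(2) that by simp
  qed
  then show ?thesis unfolding finite_proj_apply[of e F "finite_proj e F x"]
    by (simp add: finite_proj_apply[of e F x])
qed

text \<open>Since \<open>?P\<close> is self-adjoint and idempotent, the square of
  \<open>norm (?P x)\<close> equals \<open>Re (cinner x (?P x))\<close>, and Cauchy-Schwarz
  applies.\<close>

lemma norm_finite_proj_le:
  assumes "\<And>i j. cinner (e i) (e j) = (if i = j then 1 else 0)" "finite F"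
  shows "norm (finite_proj e F x) \<le> norm x"
proof -
  let ?P = "finite_proj e F"
  have "cinner (?P x) (?P x) = cinner x (?P x)"
    using cinner_cadjoint[OF compact_opsD[OF compact_ops_finite_proj], of e F x "?P x"]
    by (simp add: cadjoint_finite_proj finite_proj_idem assms)
  then have "(norm (?P x))\<^sup>2 = Re (cinner x (?P x))"
    by (metis Re_complex_of_real cinner_self)
  then have "norm (?P x) * norm (?P x) \<le> norm (?P x) * norm x"
    using Re_cinner_le[of x "?P x"] by (simp add: power2_eq_square mult.commute)
  then show ?thesis by (cases "?P x = 0") (auto simp: mult_le_cancel_left)
qed

text \<open>The fixed vectors form a subspace that contains every \<open>e j\<close> with
  \<open>j \<in> F\<close>.\<close>

lemma finite_proj_fixes_cspan:
  assumes on: "\<And>i j. cinner (e i) (e j) = (if i = j then 1 else 0)" and "finite F"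
    and "v \<in> cspan (e ` F)"
  shows "finite_proj e F v = v"
proof -
  have lin: "clinear (blinfun_apply (finite_proj e F))"
    by (rule compact_opsD[OF compact_ops_finite_proj])
  have "cspan (e ` F) \<subseteq> {v. finite_proj e F v = v}"
  proof (rule complex_vector.span_minimal)
    have "finite_proj e F (e j) = (\<Sum>i\<in>F. if j = i then e i else 0)" for j
      unfolding finite_proj_apply by (rule sum.cong) (auto simp: on)
    then show "e ` F \<subseteq> {v. finite_proj e F v = v}" using \<open>finite F\<close> by auto
    show "complex_vector.subspace {v. finite_proj e F v = v}"
      by (rule complex_vector.subspaceI) (auto simp: blinfun.add_right clinear_scaleC[OF lin])
  qed
  then show ?thesis using assms(3) by blast
qed

lemma finite_subset_cspan:
  assumes "finite K" "K \<subseteq> cspan (range e)"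
  obtains F where "finite F" "K \<subseteq> cspan (e ` F)"
proof -
  have "\<exists>F. finite F \<and> v \<in> cspan (e ` F)" if "v \<in> K" for v
  proof -
    have "v \<in> cspan (range e)" using that assms(2) by blast
    then obtain S c where S: "finite S" "S \<subseteq> range e" "v = (\<Sum>a\<in>S. c a *\<^sub>C a)"
      by (auto simp: complex_vector.span_explicit)
    have "v \<in> cspan S"
      unfolding S(3) by (simp add: complex_vector.span_sum complex_vector.span_scale complex_vector.span_base)
    moreover obtain F where "finite F" "S = e ` F" using finite_subset_image[OF S(1,2)] by auto
    ultimately show ?thesis by blast
  qed
  then obtain F where F: "\<And>v. v \<in> K \<Longrightarrow> finite (F v) \<and> v \<in> cspan (e ` F v)" by metis
  have "K \<subseteq> cspan (e ` (\<Union>v\<in>K. F v))"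
    using F complex_vector.span_mono[of "e ` F _" "e ` (\<Union>v\<in>K. F v)"] by blast
  then show ?thesis using F assms(1) by (intro that[of "\<Union>v\<in>K. F v"]) auto
qed

text \<open>The image of the unit ball has a finite net in the dense span of the basis. A projection
  fixing that net moves no point of the image far, because it is a contraction.\<close>

lemma compact_ops_approx:
  assumes e: "orthonormal_basis e" and A: "A \<in> compact_ops" and d: "0 < d"
  obtains F where "finite F" "norm ((finite_proj e F o\<^sub>L A) - A) < d"
proof -
  have on: "\<And>i j. cinner (e i) (e j) = (if i = j then 1 else 0)"
    and dense: "closure (cspan (range e)) = UNIV"
    using e by (auto simp: orthonormal_basis_def)
  \<comment> \<open>The error below is at most \<open>2 * r\<close>, so any positive
    \<open>r\<close> with \<open>2 * r < d\<close> would serve.\<close>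
  define r where "r = d / 5"
  have r: "0 < r" using d by (simp add: r_def)
  have cpt: "compact (closure (A ` cball 0 1))" using A by (simp add: compact_ops_def)
  have cover: "closure (A ` cball 0 1) \<subseteq> (\<Union>v\<in>cspan (range e). ball v r)"
  proof
    fix u
    have "u \<in> closure (cspan (range e))" using dense by simp
    then show "u \<in> (\<Union>v\<in>cspan (range e). ball v r)"
      using r by (auto simp: closure_approachable)
  qed
  obtain K where K: "K \<subseteq> cspan (range e)" "finite K" "closure (A ` cball 0 1) \<subseteq> (\<Union>v\<in>K. ball v r)"
    using compactE_image[OF cpt _ cover] by (metis open_ball)
  obtain F where F: "finite F" "K \<subseteq> cspan (e ` F)" using finite_subset_cspan K by metis
  let ?P = "finite_proj e F"
  have unit: "norm (?P (A h) - A h) \<le> 2 * r" if "norm h \<le> 1" for h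
  proof -
    have "A h \<in> closure (A ` cball 0 1)" using that closure_subset by fastforce
    then obtain v where v: "v \<in> K" "norm (A h - v) < r"
      using K(3) by (force simp: dist_norm norm_minus_commute)
    then have Pv: "?P v = v" using F by (intro finite_proj_fixes_cspan[OF on]) auto
    have "norm (?P (A h) - A h) = norm (?P (A h - v) - (A h - v))"
      by (simp add: blinfun.diff_right Pv)
    also have "\<dots> \<le> norm (?P (A h - v)) + norm (A h - v)" by (rule norm_triangle_ineq4)
    also have "\<dots> \<le> 2 * r" using norm_finite_proj_le[OF on F(1), of "A h - v"] v(2) by simp
    finally show ?thesis .
  qed
  have "norm ((?P o\<^sub>L A) - A) \<le> 2 * r"
  proof (rule norm_blinfun_bound)
    fix h
    \<comment> \<open>Homogeneity carries the estimate from the unit ball to all \<open>h\<close>;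
      \<open>sgn 0 = 0\<close> covers the zero vector.\<close>
    have "((?P o\<^sub>L A) - A) h = norm h *\<^sub>R (?P (A (sgn h)) - A (sgn h))"
      by (cases "h = 0")
        (simp_all add: blinfun.diff_left sgn_div_norm blinfun.scaleR_right scaleR_diff_right)
    also have "norm \<dots> \<le> norm h * (2 * r)"
      using unit[of "sgn h"] by (simp add: norm_sgn mult_left_mono)
    finally show "norm (((?P o\<^sub>L A) - A) h) \<le> 2 * r * norm h" by (simp add: mult.commute)
  qed (use r in simp)
  then have "norm ((?P o\<^sub>L A) - A) < d" using r by (simp add: r_def)
  with F(1) show ?thesis by (rule that)
qed


section \<open>The shift on the standard module\<close>

lemma Rep_std_module_scaleR: "Rep_std_module (r *\<^sub>R x) j = r *\<^sub>R Rep_std_module x j"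
  by (simp add: scaleC_std_module.rep_eq flip: scaleC_of_real)

lemma Rep_std_module_minus: "Rep_std_module (x - y) j = Rep_std_module x j - Rep_std_module y j"
proof -
  have "Rep_std_module x j = Rep_std_module (x - y + y) j" by simp
  also have "\<dots> = Rep_std_module (x - y) j + Rep_std_module y j" by (simp only: plus_std_module.rep_eq)
  finally show ?thesis by simp
qed

lemma Rep_std_module_sgn: "Rep_std_module (sgn x) j = inverse (norm x) *\<^sub>R Rep_std_module x j"
  by (simp add: sgn_div_norm Rep_std_module_scaleR)

lemma gnorm_tendsto_norm: "(\<lambda>n. gnorm {..<n} (Rep_std_module x)) \<longlonglongrightarrow> norm x"
  unfolding gnorm_def gram_def norm_std_module_def module_inner_def
  by (intro tendsto_intros summable_LIMSEQ Rep_std_module_summable)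

text \<open>Together with \<open>gnorm_le\<close> this reduces bounds on the module norm to
  square-sum estimates at each vector \<open>h\<close>.\<close>

lemma norm_std_module_leI: "(\<And>n. gnorm {..<n} (Rep_std_module x) \<le> C) \<Longrightarrow> norm x \<le> C"
  by (rule LIMSEQ_le_const2[OF gnorm_tendsto_norm]) auto

text \<open>Coordinate \<open>j\<close> is one term of the square sum over
  \<open>{..<Suc j}\<close>, and the seminorms over initial segments increase to the norm.\<close>

lemma norm_Rep_std_module_le: "norm (Rep_std_module x j) \<le> norm x"
proof (rule norm_blinfun_bound)
  fix h
  have "gnorm {..<Suc j} (Rep_std_module x) \<le> norm x"
    by (rule incseq_le[OF _ gnorm_tendsto_norm])
      (auto intro!: monoI gnorm_mono Rep_std_module_clinear[rule_format])
  moreover have "norm (Rep_std_module x j h) \<le> L2_set (\<lambda>j. norm (Rep_std_module x j h)) {..<Suc j}"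
    by (rule member_le_L2_set) auto
  moreover note L2_le_gnorm[OF Rep_std_module_clinear, of x h "{..<Suc j}"]
  ultimately show "norm (Rep_std_module x j h) \<le> norm x * norm h"
    by (meson mult_right_mono norm_ge_zero order_trans)
qed simp

lift_definition module_shift :: "'h :: complex_hilbert std_module \<Rightarrow> 'h std_module"
  is "\<lambda>x j. case j of 0 \<Rightarrow> 0 | Suc i \<Rightarrow> x i"
  by (subst summable_Suc_iff[symmetric]) (auto simp: compact_ops_zero split: nat.split)

lemma norm_module_shift: "norm (module_shift x) = norm x"
proof -
  have "module_inner (module_shift x) (module_shift x) = module_inner x x"
    unfolding module_inner_def
    using suminf_split_head[OF Rep_std_module_summable, of "module_shift x"]
    by (simp add: module_shift.rep_eq)
  then show ?thesis by (simp add: norm_std_module_def)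
qed

definition module_shift4 :: "'h :: complex_hilbert std_module \<Rightarrow> 'h std_module"
  where "module_shift4 x = 4 *\<^sub>R module_shift x"

lemma Rep_module_shift4_pow:
  "Rep_std_module ((module_shift4 ^^ N) x) j = (if j < N then 0 else 4 ^ N *\<^sub>R Rep_std_module x (j - N))"
  by (induction N arbitrary: j)
    (auto simp: module_shift4_def Rep_std_module_scaleR module_shift.rep_eq split: nat.split)

lemma std_module_eqI: "(\<And>j. Rep_std_module x j = Rep_std_module y j) \<Longrightarrow> x = y"
  by (simp add: Rep_std_module_inject[symmetric] fun_eq_iff)

lemma bounded_clinear_module_shift4: "bounded_clinear module_shift4"
  unfolding bounded_clinear_def
proof (intro conjI exI allI)
  show "clinear module_shift4"
    unfolding module_shift4_def
    by (rule clinearI; rule std_module_eqI)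
      (auto simp: Rep_std_module_scaleR module_shift.rep_eq plus_std_module.rep_eq
        scaleC_std_module.rep_eq scaleR_add_right scaleR_scaleC split: nat.split)
  show "norm (module_shift4 x) \<le> 4 * norm x" for x :: "'a std_module"
    by (simp add: module_shift4_def norm_module_shift)
qed

section \<open>Truncations and single entries in the module\<close>

lift_definition module_trunc :: "nat \<Rightarrow> 'h :: complex_hilbert std_module \<Rightarrow> 'h std_module"
  is "\<lambda>n x j. if j < n then x j else 0"
proof (intro conjI allI)
  fix n and x :: "nat \<Rightarrow> 'h \<Rightarrow>\<^sub>L 'h"
  show "summable (\<lambda>j. cadjoint (if j < n then x j else 0) o\<^sub>L (if j < n then x j else 0))"
    by (rule summable_finite[of "{..<n}"]) auto
qed (auto simp: compact_ops_zero)

text \<open>Entries of the module must be compact, so a non-compact \<open>A\<close> yields the zero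
  sequence by default.\<close>

lift_definition module_single :: "nat \<Rightarrow> ('h :: complex_hilbert \<Rightarrow>\<^sub>L 'h) \<Rightarrow> 'h std_module"
  is "\<lambda>k A j. if j = k \<and> A \<in> compact_ops then A else 0"
proof (intro conjI allI)
  fix k and A :: "'h \<Rightarrow>\<^sub>L 'h"
  show "summable (\<lambda>j. cadjoint (if j = k \<and> A \<in> compact_ops then A else 0) o\<^sub>L
      (if j = k \<and> A \<in> compact_ops then A else 0))"
    by (rule summable_finite[of "{k}"]) auto
qed (auto simp: compact_ops_zero)

lemma norm_module_single_le: "norm (module_single k A) \<le> norm A"
proof (rule norm_std_module_leI, rule gnorm_le[OF Rep_std_module_clinear])
  fix n h
  have "L2_set (\<lambda>j. norm (Rep_std_module (module_single k A) j h)) {..<n}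
      \<le> L2_set (\<lambda>j. if j = k then norm (A h) else 0) {..<n}"
    by (rule L2_set_mono) (auto simp: module_single.rep_eq)
  also have "\<dots> \<le> norm (A h)"
    by (auto simp: L2_set_def if_distrib[of "\<lambda>x. x\<^sup>2"] cong: if_cong)
  finally show "L2_set (\<lambda>j. norm (Rep_std_module (module_single k A) j h)) {..<n} \<le> norm A * norm h"
    using norm_blinfun[of A h] by linarith
qed simp

lemma module_trunc_tendsto: "(\<lambda>n. module_trunc n x) \<longlonglongrightarrow> x"
proof (rule LIMSEQ_I)
  fix d :: real assume d: "0 < d"
  \<comment> \<open>The half leaves room for strictness: bounds on the seminorms pass to the norm
    only as weak inequalities.\<close>
  obtain N where N: "\<And>m n. m \<ge> N \<Longrightarrow> gnorm {m..<n} (Rep_std_module x) < d / 2"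
    using gnorm_tail[of "d / 2" x] d by auto
  have "norm (module_trunc m x - x) \<le> d / 2" if "m \<ge> N" for m
  proof (rule norm_std_module_leI, rule gnorm_le[OF Rep_std_module_clinear])
    fix n h
    \<comment> \<open>The difference vanishes below \<open>m\<close> and is the negative of
      \<open>x\<close> from \<open>m\<close> on; for \<open>n \<le> m\<close> both sides are
      zero.\<close>
    have "L2_set (\<lambda>j. norm (Rep_std_module (module_trunc m x - x) j h)) {..<n} =
        L2_set (\<lambda>j. norm (Rep_std_module x j h)) {m..<n}"
      unfolding L2_set_def
      by (intro arg_cong[where f = sqrt] sum.mono_neutral_cong_right)
        (auto simp: Rep_std_module_minus module_trunc.rep_eq blinfun.minus_left)
    also have "\<dots> \<le> gnorm {m..<n} (Rep_std_module x) * norm h"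
      by (rule L2_le_gnorm[OF Rep_std_module_clinear])
    also have "\<dots> \<le> d / 2 * norm h"
      using N[OF that, of n] by (intro mult_right_mono) auto
    finally show "L2_set (\<lambda>j. norm (Rep_std_module (module_trunc m x - x) j h)) {..<n} \<le> d / 2 * norm h" .
  qed (use d in simp)
  then show "\<exists>no. \<forall>n\<ge>no. norm (module_trunc n x - x) < d"
    using d by (metis field_sum_of_halves less_add_same_cancel1 half_gt_zero order_le_less_trans)
qed

lemma not_eps_cyclic_module_shift4:
  fixes A :: "'h :: complex_hilbert \<Rightarrow>\<^sub>L 'h"
  assumes "A \<in> compact_ops" "A \<noteq> 0" "\<epsilon> < 1"
  shows "\<not> eps_cyclic \<epsilon> (module_shift4 :: 'h std_module \<Rightarrow> 'h std_module)"
proof (rule not_eps_cyclicI[where p = "\<lambda>x. Rep_std_module x 0" and y = "module_single 0 A"])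
  show "clinear (\<lambda>x :: 'h std_module. Rep_std_module x 0)"
    by (rule clinearI) (simp_all add: plus_std_module.rep_eq scaleC_std_module.rep_eq)
  show "norm (Rep_std_module x 0) \<le> norm x" for x :: "'h std_module"
    by (rule norm_Rep_std_module_le)
  show "Rep_std_module (module_shift4 x) 0 = 0" for x :: "'h std_module"
    using Rep_module_shift4_pow[of 1 x 0] by simp
  have A: "Rep_std_module (module_single 0 A) 0 = A"
    using assms(1) by (simp add: module_single.rep_eq)
  show "norm (Rep_std_module (module_single 0 A) 0) = norm (module_single 0 A)"
    using norm_Rep_std_module_le[of "module_single 0 A" 0] norm_module_single_le[of 0 A]
    by (simp add: A)
  show "module_single 0 A \<noteq> 0" using A assms(2) by (auto simp: zero_std_module.rep_eq)
qed (rule assms(3))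

lemma cstar_transitive_module_shift4:
  fixes e :: "'i \<Rightarrow> 'h :: complex_hilbert"
  assumes e: "orthonormal_basis e"
  shows "cstar_transitive (module_shift4 :: 'h std_module \<Rightarrow> 'h std_module)"
  unfolding cstar_transitive_def
proof (intro allI impI, elim conjE)
  fix W :: "('h std_module \<times> 'h std_module) set" and U :: "('h \<Rightarrow>\<^sub>L 'h) set"
  assume W: "openin (top_of_set (sphere 0 1 \<times> sphere 0 1)) W" "W \<noteq> {}"
    and U: "openin (top_of_set compact_ops) U" "U \<noteq> {}"
  obtain x y where xy: "(x, y) \<in> W" using W(2) by auto
  then have norm: "norm x = 1" "norm y = 1" using openin_imp_subset[OF W(1)] by auto
  obtain A where A: "A \<in> U" using U(2) by blast
  then have Ac: "A \<in> compact_ops" using openin_imp_subset[OF U(1)] by blast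
  obtain d where d: "0 < d" "\<And>B. B \<in> compact_ops \<Longrightarrow> dist B A < d \<Longrightarrow> B \<in> U"
    using U(1) A by (auto simp: openin_euclidean_subtopology_iff)
  \<comment> \<open>With the identity as entry of \<open>Y n\<close> the value would be exactly
    \<open>A\<close>, but the identity is not compact in infinite dimension. A finite-rank
    projection \<open>P\<close> replaces it, chosen so that \<open>P o\<^sub>L A\<close> still lies
    in \<open>U\<close>.\<close>
  obtain F where F: "norm ((finite_proj e F o\<^sub>L A) - A) < d"
    using compact_ops_approx[OF e Ac d(1)] by blast
  define P where "P = finite_proj e F"
  have Pc: "P \<in> compact_ops" and Padj: "cadjoint P = P"
    by (simp_all add: P_def compact_ops_finite_proj cadjoint_finite_proj)
  have PAc: "P o\<^sub>L A \<in> compact_ops" using Ac Pc by (intro compact_ops_compose_right compact_opsD)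
  then have PAU: "P o\<^sub>L A \<in> U" using F by (intro d(2)) (simp_all add: P_def dist_norm)
  \<comment> \<open>The two vectors vary independently, so each needs a single added entry: the
    shift carries the \<open>A\<close> of \<open>X n\<close> onto the \<open>P\<close> of
    \<open>Y n\<close>.\<close>
  define X where "X n = module_trunc n x + (1/2) ^ Suc n *\<^sub>R module_single n A" for n
  define Y where "Y n = module_trunc n y + (1/2) ^ Suc n *\<^sub>R module_single (n + Suc n) P" for n
  have "X \<longlonglongrightarrow> x + 0"
    unfolding X_def
    by (intro tendsto_add module_trunc_tendsto tendsto_inverse_power2_scaleR[where K = "norm A"]
        norm_module_single_le)
  moreover have "Y \<longlonglongrightarrow> y + 0"
    unfolding Y_def
    by (intro tendsto_add module_trunc_tendsto tendsto_inverse_power2_scaleR[where K = "norm P"]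
        norm_module_single_le)
  ultimately have X: "X \<longlonglongrightarrow> x" and Y: "Y \<longlonglongrightarrow> y" by simp_all
  have nz: "x \<noteq> 0" "y \<noteq> 0" using norm by auto
  have lim: "(\<lambda>n. (sgn (X n), sgn (Y n))) \<longlonglongrightarrow> (x, y)"
    by (intro tendsto_Pair tendsto_sgn_unit X Y norm)
  have "\<forall>\<^sub>F n in sequentially. (sgn (X n), sgn (Y n)) \<in> sphere 0 1 \<times> sphere 0 1"
    using eventually_norm_sgn[OF X nz(1)] eventually_norm_sgn[OF Y nz(2)] by eventually_elim simp
  then have inW: "\<forall>\<^sub>F n in sequentially. (sgn (X n), sgn (Y n)) \<in> W"
    by (rule eventually_openin[OF W(1) xy lim])
  define r where "r n = inverse (norm (X n)) * inverse (norm (Y n))" for n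
  have inner: "module_inner ((module_shift4 ^^ Suc n) (sgn (X n))) (sgn (Y n)) = r n *\<^sub>R (P o\<^sub>L A)" for n
  proof -
    let ?m = "n + Suc n"
    \<comment> \<open>The shifted \<open>X n\<close> lives on the coordinates from
      \<open>Suc n\<close> to \<open>?m\<close>, and \<open>Y n\<close> on those below
      \<open>n\<close> and on \<open>?m\<close>, so one term remains. It involves
      \<open>cadjoint P = P\<close>.\<close>
    have "module_inner ((module_shift4 ^^ Suc n) (sgn (X n))) (sgn (Y n)) =
      (\<Sum>j\<in>{?m}. cadjoint (Rep_std_module (sgn (Y n)) j) o\<^sub>L
        Rep_std_module ((module_shift4 ^^ Suc n) (sgn (X n))) j)"
      unfolding module_inner_def
      by (rule suminf_finite)
        (auto simp: Rep_module_shift4_pow X_def Y_def Rep_std_module_sgn plus_std_module.rep_eq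
          Rep_std_module_scaleR module_trunc.rep_eq module_single.rep_eq cadjoint_zero
          simp del: funpow.simps)
    also have "\<dots> = r n *\<^sub>R ((4 * (1/2) * (1/2)) ^ Suc n *\<^sub>R (P o\<^sub>L A))"
      unfolding power_mult_distrib
      by (simp add: Rep_module_shift4_pow X_def Y_def Rep_std_module_sgn plus_std_module.rep_eq
          Rep_std_module_scaleR module_trunc.rep_eq module_single.rep_eq Ac Pc cadjoint_scaleR
          compact_opsD Padj r_def bounded_bilinear.scaleR_left[OF bounded_bilinear_blinfun_compose]
          bounded_bilinear.scaleR_right[OF bounded_bilinear_blinfun_compose] mult_ac
          del: funpow.simps)
    finally show ?thesis by simp
  qed
  have "(\<lambda>n. r n *\<^sub>R (P o\<^sub>L A)) \<longlonglongrightarrow> (inverse (norm x) * inverse (norm y)) *\<^sub>R (P o\<^sub>L A)"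
    unfolding r_def using nz by (intro tendsto_intros X Y) auto
  then have "\<forall>\<^sub>F n in sequentially. r n *\<^sub>R (P o\<^sub>L A) \<in> U"
    \<comment> \<open>\<open>U\<close> is open only relative to \<open>compact_ops\<close>, so the
      real multiples of \<open>P o\<^sub>L A\<close> must be seen to be compact as well.\<close>
    by (intro eventually_openin[OF U(1) PAU]) (simp_all add: norm compact_ops_scaleR PAc)
  with inW have "\<forall>\<^sub>F n in sequentially. (sgn (X n), sgn (Y n)) \<in> W \<and>
      module_inner ((module_shift4 ^^ Suc n) (sgn (X n))) (sgn (Y n)) \<in> U"
    by eventually_elim (simp only: inner simp_thms)
  then obtain n where "(sgn (X n), sgn (Y n)) \<in> W"
    "module_inner ((module_shift4 ^^ Suc n) (sgn (X n))) (sgn (Y n)) \<in> U"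
    using eventually_happens'[OF sequentially_bot] by blast
  then show "\<exists>n. \<exists>(x, y)\<in>W. module_inner ((module_shift4 ^^ n) x) y \<in> U" by blast
qed

theorem corollary4p12:
  shows "(\<exists>T :: nat ell2 \<Rightarrow> nat ell2.
            bounded_clinear T \<and> top_numerically_transitive T \<and>
            (\<forall>\<epsilon>. 0 < \<epsilon> \<and> \<epsilon> < 1 \<longrightarrow> \<not> eps_cyclic \<epsilon> T)) \<and>
         (\<forall>e :: int \<Rightarrow> 'h :: complex_hilbert. orthonormal_basis e \<longrightarrow>
           (\<exists>T :: 'h std_module \<Rightarrow> 'h std_module.
              bounded_clinear T \<and> cstar_transitive T \<and>
              (\<forall>\<epsilon>. 0 < \<epsilon> \<and> \<epsilon> < 1 \<longrightarrow> \<not> eps_cyclic \<epsilon> T)))"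
proof (intro conjI allI impI)
  show "\<exists>T :: nat ell2 \<Rightarrow> nat ell2. bounded_clinear T \<and> top_numerically_transitive T \<and>
      (\<forall>\<epsilon>. 0 < \<epsilon> \<and> \<epsilon> < 1 \<longrightarrow> \<not> eps_cyclic \<epsilon> T)"
    using bounded_clinear_ell2_shift4 top_numerically_transitive_ell2_shift4
      not_eps_cyclic_ell2_shift4 by blast
next
  fix e :: "int \<Rightarrow> 'h"
  assume e: "orthonormal_basis e"
  \<comment> \<open>The basis supplies a nonzero compact operator, the projection onto the line of
    \<open>e 0\<close>, to place in coordinate zero.\<close>
  then have "cinner (e 0) (e 0) = 1" by (simp add: orthonormal_basis_def)
  then have "rank_one (e 0) (e 0) = e 0" "e 0 \<noteq> 0" by (auto simp: rank_one.rep_eq)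
  then have "rank_one (e 0) \<noteq> 0" by auto
  then show "\<exists>T :: 'h std_module \<Rightarrow> 'h std_module. bounded_clinear T \<and> cstar_transitive T \<and>
      (\<forall>\<epsilon>. 0 < \<epsilon> \<and> \<epsilon> < 1 \<longrightarrow> \<not> eps_cyclic \<epsilon> T)"
    using bounded_clinear_module_shift4 cstar_transitive_module_shift4[OF e]
      not_eps_cyclic_module_shift4[OF compact_ops_rank_one] by blast
qed

end
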